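(* For every topological space $X$, $\mathbf\Pi X$ (with the structure described in the context) is a double groupoid satisfying the filling condition.
   Context: **Double groupoids.** A double category consists of sets $O$ (objects), $H$ (horizontal morphisms), $V$ (vertical morphisms), $C$ (squares) with four category structures $(H,O,s^h,t^h,I^h,\circ_h)$, $(V,O,s^v,t^v,I^v,\circ_v)$, $(C,V,s^h,t^h,I^h,\circ_h)$, $(C,H,s^v,t^v,I^v,\circ_v)$ (sources, targets, identities, compositions; $f\circ g$ is defined when source of $f$ = target of $g$) such that: (1) $s^hs^v=s^vs^h$, $t^ht^v=t^vt^h$, $s^ht^v=t^vs^h$, $s^vt^h=t^hs^v$ on squares; $s^hI^v=I^vs^h$, $t^hI^v=I^vt^h$, $s^vI^h=I^hs^v$, $t^vI^h=I^ht^v$; $I^hI^v=I^vI^h$ on objects; (2) $s^v,t^v$ on squares preserve $\circ_h$, $s^h,t^h$ on squares preserve $\circ_v$, $I^v(f\circ_hf')=I^vf\circ_hI^vf'$, $I^h(u\circ_vu')=I^hu\circ_vI^hu'$; (3) interchange: $(\alpha\circ_h\beta)\circ_v(\gamma\circ_h\delta)=(\alpha\circ_v\gamma)\circ_h(\beta\circ_v\delta)$ whenever defined. It is a double groupoid if all four categories are groupoids. Filling condition: for every horizontal $g$ and vertical $u$ with $s^hg=t^vu$ there is a square $\alpha$ with $s^h\alpha=u$, $t^v\alpha=g$. **The data $\mathbf\Pi X$** for a space $X$, $I=[0,1]$. Objects: paths (continuous maps) $u:I\to X$. There is a unique horizontal morphism $u\to u'$ if $u(1)=u'(1)$ and none otherwise;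 a unique vertical morphism $u\to v$ if $u(0)=v(0)$ and none otherwise. A square with $s^h=(u\to v)$, $t^h=(u'\to v')$, $s^v=(u\to u')$, $t^v=(v\to v')$ is a homotopy class $[\alpha]$ rel $\partial(I^2)$ of continuous maps $\alpha:I^2\to X$ with $\alpha(x,0)=u(x)$, $\alpha(0,y)=v(y)$, $\alpha(1,1-y)=u'(y)$, $\alpha(1-x,1)=v'(x)$. Compositions are $[\alpha']\circ_h[\alpha]=[\alpha'\circ_h\alpha]$ and $[\beta]\circ_v[\alpha]=[\beta\circ_v\alpha]$ (well defined on homotopy classes) where $(\alpha'\circ_h\alpha)(x,y)$ is $\alpha(2x,x+y)$ if $x\le y,x+y\le1$; $\alpha(x+y,2y)$ if $x\ge y,x+y\le1$; $\alpha'(x+y-1,2y-1)$ if $x\le y,x+y\ge1$; $\alpha'(2x-1,x+y-1)$ if $x\ge y,x+y\ge1$; $(\beta\circ_v\alpha)(x,y)$ is $\alpha(2x-1,1-x+y)$ if $x\ge y,x+y\ge1$; $\alpha(x-y,2y)$ if $x\ge y,x+y\le1$; $\beta(1+x-y,2y-1)$ if $x\le y,x+y\ge1$; $\beta(2x,y-x)$ if $x\le y,x+y\le1$. The identity square $I^h(u\to v)$ on a vertical morphism is the class of $e^h(x,y)=v(y-x)$ for $x\le y$, $u(x-y)$ for $x\ge y$; the identity square $I^v(u\to u')$ on a horizontal morphism is the class of $e^v(x,y)=u(x+y)$ for $x+y\le1$, $u'(2-x-y)$ for $x+y\ge1$. *)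

theory Defs
  imports "HOL-Analysis.Analysis"
begin

section \<open>Double groupoids\<close>

text \<open>
  Small categories are given by carrier sets. The composite \<open>f \<cdot> g\<close> is meaningful only if the source
  of \<open>f\<close> is the target of \<open>g\<close>; the values of the total HOL function on other pairs are never
  constrained.
\<close>

locale category =
  fixes Arr :: "'m set" and Ob :: "'o set"
    and src tgt :: "'m \<Rightarrow> 'o" and idt :: "'o \<Rightarrow> 'm"
    and comp :: "'m \<Rightarrow> 'm \<Rightarrow> 'm" (infixl "\<cdot>" 70)
  assumes src_closed: "f \<in> Arr \<Longrightarrow> src f \<in> Ob"
    and tgt_closed: "f \<in> Arr \<Longrightarrow> tgt f \<in> Ob"
    and idt_closed: "x \<in> Ob \<Longrightarrow> idt x \<in> Arr"
    and src_idt: "x \<in> Ob \<Longrightarrow> src (idt x) = x"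
    and tgt_idt: "x \<in> Ob \<Longrightarrow> tgt (idt x) = x"
    and comp_closed: "\<lbrakk>f \<in> Arr; g \<in> Arr; src f = tgt g\<rbrakk> \<Longrightarrow> f \<cdot> g \<in> Arr"
    and src_comp: "\<lbrakk>f \<in> Arr; g \<in> Arr; src f = tgt g\<rbrakk> \<Longrightarrow> src (f \<cdot> g) = src g"
    and tgt_comp: "\<lbrakk>f \<in> Arr; g \<in> Arr; src f = tgt g\<rbrakk> \<Longrightarrow> tgt (f \<cdot> g) = tgt f"
    and comp_assoc: "\<lbrakk>f \<in> Arr; g \<in> Arr; h \<in> Arr; src f = tgt g; src g = tgt h\<rbrakk>
                       \<Longrightarrow> (f \<cdot> g) \<cdot> h = f \<cdot> (g \<cdot> h)"
    and comp_idt_right: "f \<in> Arr \<Longrightarrow> f \<cdot> idt (src f) = f"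
    and comp_idt_left: "f \<in> Arr \<Longrightarrow> idt (tgt f) \<cdot> f = f"

locale groupoid = category +
  assumes inverse_ex: "f \<in> Arr \<Longrightarrow>
    \<exists>g\<in>Arr. src g = tgt f \<and> tgt g = src f \<and> g \<cdot> f = idt (src f) \<and> f \<cdot> g = idt (tgt f)"

text \<open>
  Fields starting with a lower case letter belong to the categories of horizontal and vertical
  morphisms; the capitalised versions are the operations on squares. Note that the horizontal
  source and target of a square are vertical morphisms, and vice versa.
\<close>

record ('o, 'h, 'v, 'c) double_structure =
  Obj :: "'o set"
  Hor :: "'h set"
  Ver :: "'v set"
  Sqr :: "'c set"
  hsrc :: "'h \<Rightarrow> 'o"
  htgt :: "'h \<Rightarrow> 'o"
  hidt :: "'o \<Rightarrow> 'h"
  hcomp :: "'h \<Rightarrow> 'h \<Rightarrow> 'h"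
  vsrc :: "'v \<Rightarrow> 'o"
  vtgt :: "'v \<Rightarrow> 'o"
  vidt :: "'o \<Rightarrow> 'v"
  vcomp :: "'v \<Rightarrow> 'v \<Rightarrow> 'v"
  Hsrc :: "'c \<Rightarrow> 'v"
  Htgt :: "'c \<Rightarrow> 'v"
  Hidt :: "'v \<Rightarrow> 'c"
  Hcomp :: "'c \<Rightarrow> 'c \<Rightarrow> 'c"
  Vsrc :: "'c \<Rightarrow> 'h"
  Vtgt :: "'c \<Rightarrow> 'h"
  Vidt :: "'h \<Rightarrow> 'c"
  Vcomp :: "'c \<Rightarrow> 'c \<Rightarrow> 'c"

locale double_category =
  hor: category "Hor D" "Obj D" "hsrc D" "htgt D" "hidt D" "hcomp D" +
  ver: category "Ver D" "Obj D" "vsrc D" "vtgt D" "vidt D" "vcomp D" +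
  Hor: category "Sqr D" "Ver D" "Hsrc D" "Htgt D" "Hidt D" "Hcomp D" +
  Ver: category "Sqr D" "Hor D" "Vsrc D" "Vtgt D" "Vidt D" "Vcomp D"
  for D :: "('o, 'h, 'v, 'c) double_structure" +
  assumes src_src: "a \<in> Sqr D \<Longrightarrow> hsrc D (Vsrc D a) = vsrc D (Hsrc D a)"
    and tgt_tgt: "a \<in> Sqr D \<Longrightarrow> htgt D (Vtgt D a) = vtgt D (Htgt D a)"
    and hsrc_Vtgt: "a \<in> Sqr D \<Longrightarrow> hsrc D (Vtgt D a) = vtgt D (Hsrc D a)"
    and vsrc_Htgt: "a \<in> Sqr D \<Longrightarrow> vsrc D (Htgt D a) = htgt D (Vsrc D a)"
    and Hsrc_Vidt: "f \<in> Hor D \<Longrightarrow> Hsrc D (Vidt D f) = vidt D (hsrc D f)"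
    and Htgt_Vidt: "f \<in> Hor D \<Longrightarrow> Htgt D (Vidt D f) = vidt D (htgt D f)"
    and Vsrc_Hidt: "u \<in> Ver D \<Longrightarrow> Vsrc D (Hidt D u) = hidt D (vsrc D u)"
    and Vtgt_Hidt: "u \<in> Ver D \<Longrightarrow> Vtgt D (Hidt D u) = hidt D (vtgt D u)"
    and Hidt_vidt: "x \<in> Obj D \<Longrightarrow> Hidt D (vidt D x) = Vidt D (hidt D x)"
    and Vsrc_Hcomp: "\<lbrakk>a \<in> Sqr D; b \<in> Sqr D; Hsrc D a = Htgt D b\<rbrakk>
          \<Longrightarrow> Vsrc D (Hcomp D a b) = hcomp D (Vsrc D a) (Vsrc D b)"
    and Vtgt_Hcomp: "\<lbrakk>a \<in> Sqr D; b \<in> Sqr D; Hsrc D a = Htgt D b\<rbrakk>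
          \<Longrightarrow> Vtgt D (Hcomp D a b) = hcomp D (Vtgt D a) (Vtgt D b)"
    and Hsrc_Vcomp: "\<lbrakk>a \<in> Sqr D; b \<in> Sqr D; Vsrc D a = Vtgt D b\<rbrakk>
          \<Longrightarrow> Hsrc D (Vcomp D a b) = vcomp D (Hsrc D a) (Hsrc D b)"
    and Htgt_Vcomp: "\<lbrakk>a \<in> Sqr D; b \<in> Sqr D; Vsrc D a = Vtgt D b\<rbrakk>
          \<Longrightarrow> Htgt D (Vcomp D a b) = vcomp D (Htgt D a) (Htgt D b)"
    and Vidt_hcomp: "\<lbrakk>f \<in> Hor D; f' \<in> Hor D; hsrc D f = htgt D f'\<rbrakk>
          \<Longrightarrow> Vidt D (hcomp D f f') = Hcomp D (Vidt D f) (Vidt D f')"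
    and Hidt_vcomp: "\<lbrakk>u \<in> Ver D; u' \<in> Ver D; vsrc D u = vtgt D u'\<rbrakk>
          \<Longrightarrow> Hidt D (vcomp D u u') = Vcomp D (Hidt D u) (Hidt D u')"
    and interchange: "\<lbrakk>a \<in> Sqr D; b \<in> Sqr D; c \<in> Sqr D; d \<in> Sqr D;
            Hsrc D a = Htgt D b; Hsrc D c = Htgt D d; Vsrc D a = Vtgt D c; Vsrc D b = Vtgt D d\<rbrakk>
          \<Longrightarrow> Vcomp D (Hcomp D a b) (Hcomp D c d) = Hcomp D (Vcomp D a c) (Vcomp D b d)"

locale double_groupoid = double_category D +
  hor: groupoid "Hor D" "Obj D" "hsrc D" "htgt D" "hidt D" "hcomp D" +
  ver: groupoid "Ver D" "Obj D" "vsrc D" "vtgt D" "vidt D" "vcomp D" +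
  Hor: groupoid "Sqr D" "Ver D" "Hsrc D" "Htgt D" "Hidt D" "Hcomp D" +
  Ver: groupoid "Sqr D" "Hor D" "Vsrc D" "Vtgt D" "Vidt D" "Vcomp D"
  for D :: "('o, 'h, 'v, 'c) double_structure"

definition filling_condition :: "('o, 'h, 'v, 'c) double_structure \<Rightarrow> bool" where
  "filling_condition D \<longleftrightarrow>
     (\<forall>g\<in>Hor D. \<forall>u\<in>Ver D. hsrc D g = vtgt D u \<longrightarrow>
        (\<exists>a\<in>Sqr D. Hsrc D a = u \<and> Vtgt D a = g))"

section \<open>The data \<open>\<Pi>X\<close>\<close>

text \<open>
  Paths and maps on the unit square are represented by their extensional HOL functions, so that
  HOL equality is equality of maps defined on the unit interval or on the unit square.
\<close>

abbreviation unit_square :: "(real \<times> real) set" where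
  "unit_square \<equiv> {0..1} \<times> {0..1}"

definition paths :: "'a topology \<Rightarrow> (real \<Rightarrow> 'a) set" where
  "paths X = {u \<in> extensional {0..1}. pathin X u}"

definition square_maps :: "'a topology \<Rightarrow> (real \<times> real \<Rightarrow> 'a) set" where
  "square_maps X = {\<alpha> \<in> extensional unit_square. continuous_map (top_of_set unit_square) X \<alpha>}"

definition homotopy_rel_boundary ::
    "'a topology \<Rightarrow> ((real \<times> real \<Rightarrow> 'a) \<times> (real \<times> real \<Rightarrow> 'a)) set" where
  "homotopy_rel_boundary X = {(\<alpha>, \<beta>). \<alpha> \<in> square_maps X \<and> \<beta> \<in> square_maps X \<and>
     homotopic_with (\<lambda>h. \<forall>z\<in>frontier unit_square. h z = \<alpha> z) (top_of_set unit_square) X \<alpha> \<beta>}"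

definition square_class :: "'a topology \<Rightarrow> (real \<times> real \<Rightarrow> 'a) \<Rightarrow> (real \<times> real \<Rightarrow> 'a) set" where
  "square_class X \<alpha> = homotopy_rel_boundary X `` {\<alpha>}"

text \<open>
  The paths \<open>u\<close>, \<open>v\<close>, \<open>u'\<close>, \<open>v'\<close> on the boundary of
  a map \<open>\<alpha>\<close>: \<open>\<alpha>(x,0) = u(x)\<close>, \<open>\<alpha>(0,y) = v(y)\<close>,
  \<open>\<alpha>(1,1-y) = u'(y)\<close>, \<open>\<alpha>(1-x,1) = v'(x)\<close>.
\<close>

definition edge_u :: "(real \<times> real \<Rightarrow> 'a) \<Rightarrow> real \<Rightarrow> 'a" where
  "edge_u \<alpha> = (\<lambda>x\<in>{0..1}. \<alpha> (x, 0))"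

definition edge_v :: "(real \<times> real \<Rightarrow> 'a) \<Rightarrow> real \<Rightarrow> 'a" where
  "edge_v \<alpha> = (\<lambda>y\<in>{0..1}. \<alpha> (0, y))"

definition edge_u' :: "(real \<times> real \<Rightarrow> 'a) \<Rightarrow> real \<Rightarrow> 'a" where
  "edge_u' \<alpha> = (\<lambda>y\<in>{0..1}. \<alpha> (1, 1 - y))"

definition edge_v' :: "(real \<times> real \<Rightarrow> 'a) \<Rightarrow> real \<Rightarrow> 'a" where
  "edge_v' \<alpha> = (\<lambda>x\<in>{0..1}. \<alpha> (1 - x, 1))"

definition hcomp_map ::
    "(real \<times> real \<Rightarrow> 'a) \<Rightarrow> (real \<times> real \<Rightarrow> 'a) \<Rightarrow> real \<times> real \<Rightarrow> 'a" where
  "hcomp_map \<alpha>' \<alpha> = (\<lambda>(x, y)\<in>unit_square.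
     if x \<le> y \<and> x + y \<le> 1 then \<alpha> (2 * x, x + y)
     else if x \<ge> y \<and> x + y \<le> 1 then \<alpha> (x + y, 2 * y)
     else if x \<le> y \<and> x + y \<ge> 1 then \<alpha>' (x + y - 1, 2 * y - 1)
     else \<alpha>' (2 * x - 1, x + y - 1))"

definition vcomp_map ::
    "(real \<times> real \<Rightarrow> 'a) \<Rightarrow> (real \<times> real \<Rightarrow> 'a) \<Rightarrow> real \<times> real \<Rightarrow> 'a" where
  "vcomp_map \<beta> \<alpha> = (\<lambda>(x, y)\<in>unit_square.
     if x \<ge> y \<and> x + y \<ge> 1 then \<alpha> (2 * x - 1, 1 - x + y)
     else if x \<ge> y \<and> x + y \<le> 1 then \<alpha> (x - y, 2 * y)
     else if x \<le> y \<and> x + y \<ge> 1 then \<beta> (1 + x - y, 2 * y - 1)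
     else \<beta> (2 * x, y - x))"

definition hid_map :: "(real \<Rightarrow> 'a) \<Rightarrow> (real \<Rightarrow> 'a) \<Rightarrow> real \<times> real \<Rightarrow> 'a" where
  "hid_map u v = (\<lambda>(x, y)\<in>unit_square. if x \<le> y then v (y - x) else u (x - y))"

definition vid_map :: "(real \<Rightarrow> 'a) \<Rightarrow> (real \<Rightarrow> 'a) \<Rightarrow> real \<times> real \<Rightarrow> 'a" where
  "vid_map u u' = (\<lambda>(x, y)\<in>unit_square. if x + y \<le> 1 then u (x + y) else u' (2 - x - y))"

text \<open>
  The unique morphism \<open>u \<rightarrow> u'\<close> (horizontal or vertical) is the pair \<open>(u, u')\<close>. A square is
  a homotopy class of maps; its boundary need not be recorded, as it is constant on the class.

  Operations on classes range over all representatives. \<open>the_elem\<close> yields the common value of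
  the boundary. A composite is the union of the classes \<open>[\<alpha>' \<circ> \<alpha>]\<close> over all representatives
  \<open>\<alpha>'\<close>, \<open>\<alpha>\<close>: it equals each of these classes if they coincide and is not a square otherwise,
  so closure of \<open>Sqr\<close> under composition entails that composition is well defined on classes.
\<close>

type_synonym 'a morphism = "(real \<Rightarrow> 'a) \<times> (real \<Rightarrow> 'a)"

definition homotopy_double_groupoid ::
    "'a topology \<Rightarrow> (real \<Rightarrow> 'a, 'a morphism, 'a morphism, (real \<times> real \<Rightarrow> 'a) set) double_structure"
  where
  "homotopy_double_groupoid X = \<lparr>
     Obj = paths X,
     Hor = {(u, u'). u \<in> paths X \<and> u' \<in> paths X \<and> u 1 = u' 1},
     Ver = {(u, v). u \<in> paths X \<and> v \<in> paths X \<and> u 0 = v 0},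
     Sqr = square_maps X // homotopy_rel_boundary X,
     hsrc = fst,
     htgt = snd,
     hidt = (\<lambda>u. (u, u)),
     hcomp = (\<lambda>g f. (fst f, snd g)),
     vsrc = fst,
     vtgt = snd,
     vidt = (\<lambda>u. (u, u)),
     vcomp = (\<lambda>g f. (fst f, snd g)),
     Hsrc = (\<lambda>c. the_elem ((\<lambda>\<alpha>. (edge_u \<alpha>, edge_v \<alpha>)) ` c)),
     Htgt = (\<lambda>c. the_elem ((\<lambda>\<alpha>. (edge_u' \<alpha>, edge_v' \<alpha>)) ` c)),
     Hidt = (\<lambda>(u, v). square_class X (hid_map u v)),
     Hcomp = (\<lambda>c' c. \<Union>\<alpha>'\<in>c'. \<Union>\<alpha>\<in>c. square_class X (hcomp_map \<alpha>' \<alpha>)),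
     Vsrc = (\<lambda>c. the_elem ((\<lambda>\<alpha>. (edge_u \<alpha>, edge_u' \<alpha>)) ` c)),
     Vtgt = (\<lambda>c. the_elem ((\<lambda>\<alpha>. (edge_v \<alpha>, edge_v' \<alpha>)) ` c)),
     Vidt = (\<lambda>(u, u'). square_class X (vid_map u u')),
     Vcomp = (\<lambda>c' c. \<Union>\<beta>\<in>c'. \<Union>\<alpha>\<in>c. square_class X (vcomp_map \<beta> \<alpha>))\<rparr>"

end

theory Submission
  imports Defs
begin

text \<open>
  In terms of the coordinates \<open>y - x\<close> and \<open>min x y\<close> on the unit square, horizontal composition is
  concatenation of paths in the second coordinate, for every value of the first. The horizontal
  groupoid laws therefore follow, as for the fundamental groupoid, from homotopies of
  reparametrisations of a single square, which are linear since the square is convex. The reflection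
  \<open>(x, y) \<mapsto> (1 - x, y)\<close> turns vertical into horizontal composition.

  In the interchange law all four squares share an edge \<open>w\<close>. Each composite is the union of the
  four squares along the diagonals of the unit square, with \<open>w\<close> running twice outwards from the
  centre, along the antidiagonal from \<open>w 1\<close> in one composite and along the diagonal from \<open>w 0\<close> in
  the other. Shrinking \<open>w\<close> on one diagonal while growing it on the other connects the two.
\<close>

section \<open>Pasting and homotopies rel boundary\<close>

text \<open>A segment of constant \<open>y - x\<close> starts on the bottom or left edge, which
  together form the horizontal source, and ends on the right or top edge, the horizontal target. In
  the parameter \<open>min x y\<close> it is the interval from 0 to L = 1 - |y - x|; it shrinks to a
  point at the corners (1, 0) and (0, 1). The frontier therefore consists of endpoints of segments,
  and two reparametrisations of the segments that agree at endpoints give maps homotopic rel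
  boundary. For associativity, the single square is one of the triple composites. The interchange
  law offers no such square: in every intermediate map four pieces have to fit along both diagonals,
  while a straight line of reparametrisations respects only convex conditions. Since X is an
  arbitrary space, no homotopy can use structure of the target; every one moves points of the
  domain.\<close>

lemma continuous_map_reparam:
  assumes "continuous_map (top_of_set T) X g" "continuous_on S r" "\<And>z. z \<in> S \<Longrightarrow> r z \<in> T"
    and "\<And>z. z \<in> S \<Longrightarrow> f z = g (r z)"
  shows "continuous_map (top_of_set S) X f"
proof -
  have "continuous_map (top_of_set S) X (g \<circ> r)"
    using assms by (intro continuous_map_compose[of _ "top_of_set T"]) auto
  then show ?thesis
    by (rule continuous_map_eq) (use assms in auto)
qed

lemma continuous_map_paste_le:
  fixes p q :: "'b::topological_space \<Rightarrow> real"
  assumes "continuous_on S p" "continuous_on S q"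
    and "continuous_map (top_of_set {z \<in> S. p z \<le> q z}) X f"
    and "continuous_map (top_of_set {z \<in> S. q z \<le> p z}) X g"
    and "\<And>z. \<lbrakk>z \<in> S; p z = q z\<rbrakk> \<Longrightarrow> f z = g z"
  shows "continuous_map (top_of_set S) X (\<lambda>z. if p z \<le> q z then f z else g z)"
proof (rule continuous_map_cases_le)
  have eq: "S \<inter> {x \<in> S. P x} = {z \<in> S. P z}" for P
    by auto
  show "continuous_map (subtopology (top_of_set S) {x \<in> topspace (top_of_set S). p x \<le> q x}) X f"
    "continuous_map (subtopology (top_of_set S) {x \<in> topspace (top_of_set S). q x \<le> p x}) X g"
    using assms by (simp_all add: subtopology_subtopology eq)
qed (use assms in auto)

lemma continuous_map_restrict:
  "continuous_map (top_of_set S) X f \<Longrightarrow> continuous_map (top_of_set S) X (restrict f S)"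
  by (erule continuous_map_eq) auto

section \<open>The homotopy relation on maps of the square\<close>

lemma frontier_unit_square:
  "(x, y) \<in> frontier unit_square \<longleftrightarrow>
     (x, y) \<in> unit_square \<and> (x = 0 \<or> x = 1 \<or> y = 0 \<or> (y::real) = 1)"
  by (auto simp: frontier_def interior_Times closure_Times)

lemma frontier_unit_square_subset: "z \<in> frontier unit_square \<Longrightarrow> z \<in> unit_square"
  by (cases z) (simp add: frontier_unit_square)

lemma homotopy_rel_boundary_iff:
  "(\<alpha>, \<beta>) \<in> homotopy_rel_boundary X \<longleftrightarrow> \<alpha> \<in> square_maps X \<and> \<beta> \<in> square_maps X \<and>
     (\<exists>H. continuous_map (top_of_set ({0..1::real} \<times> unit_square)) X H \<and>
          (\<forall>z\<in>unit_square. H (0, z) = \<alpha> z) \<and> (\<forall>z\<in>unit_square. H (1, z) = \<beta> z) \<and>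
          (\<forall>s\<in>{0..1}. \<forall>z\<in>frontier unit_square. H (s, z) = \<alpha> z))"
proof -
  have "prod_topology (top_of_set {0..1::real}) (top_of_set unit_square)
      = top_of_set ({0..1::real} \<times> unit_square)"
    by (simp add: subtopology_Times)
  then show ?thesis
    unfolding homotopy_rel_boundary_def mem_Collect_eq prod.case
    by (subst homotopic_with) (auto simp: frontier_unit_square_subset)
qed

lemma homotopy_rel_boundaryI:
  assumes "\<alpha> \<in> square_maps X" "\<beta> \<in> square_maps X"
    and "continuous_map (top_of_set ({0..1::real} \<times> unit_square)) X H"
    and "\<And>z. z \<in> unit_square \<Longrightarrow> H (0, z) = \<alpha> z" "\<And>z. z \<in> unit_square \<Longrightarrow> H (1, z) = \<beta> z"
    and "\<And>s z. \<lbrakk>s \<in> {0..1}; z \<in> frontier unit_square\<rbrakk> \<Longrightarrow> H (s, z) = \<alpha> z"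
  shows "(\<alpha>, \<beta>) \<in> homotopy_rel_boundary X"
  using assms unfolding homotopy_rel_boundary_iff by blast

lemma homotopy_rel_boundaryE:
  assumes "(\<alpha>, \<beta>) \<in> homotopy_rel_boundary X"
  obtains H where "\<alpha> \<in> square_maps X" "\<beta> \<in> square_maps X"
    and "continuous_map (top_of_set ({0..1::real} \<times> unit_square)) X H"
    and "\<And>z. z \<in> unit_square \<Longrightarrow> H (0, z) = \<alpha> z" "\<And>z. z \<in> unit_square \<Longrightarrow> H (1, z) = \<beta> z"
    and "\<And>s z. \<lbrakk>s \<in> {0..1}; z \<in> frontier unit_square\<rbrakk> \<Longrightarrow> H (s, z) = \<alpha> z"
  using assms unfolding homotopy_rel_boundary_iff by blast

lemma homotopy_rel_boundary_frontier:
  fixes X :: "'a topology"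
  assumes "(\<alpha>, \<beta>) \<in> homotopy_rel_boundary X" "z \<in> frontier unit_square"
  shows "\<beta> z = \<alpha> z"
proof -
  obtain H :: "real \<times> real \<times> real \<Rightarrow> 'a"
    where "\<And>z. z \<in> unit_square \<Longrightarrow> H (1, z) = \<beta> z"
    "\<And>s z. \<lbrakk>s \<in> {0..1}; z \<in> frontier unit_square\<rbrakk> \<Longrightarrow> H (s, z) = \<alpha> z"
    by (rule homotopy_rel_boundaryE[OF assms(1)]) blast
  then show ?thesis
    using assms(2) frontier_unit_square_subset[of z] by (metis atLeastAtMost_iff order_refl zero_le_one)
qed

lemma equiv_homotopy_rel_boundary: "equiv (square_maps X) (homotopy_rel_boundary X)"
proof (rule equivI)
  show "refl_on (square_maps X) (homotopy_rel_boundary X)"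
    by (rule refl_onI) (auto simp: homotopy_rel_boundary_def square_maps_def)
  show "homotopy_rel_boundary X \<subseteq> square_maps X \<times> square_maps X"
    by (auto simp: homotopy_rel_boundary_def)
  \<comment> \<open>The relation makes all intermediate maps agree on the frontier with its
    left-hand member. Symmetry and transitivity change that member, so the condition is transported
    between maps with the same frontier values.\<close>
  have *: "homotopic_with (\<lambda>h. \<forall>z\<in>frontier unit_square. h z = \<beta> z) (top_of_set unit_square) X \<alpha> \<gamma>
      \<longleftrightarrow> homotopic_with (\<lambda>h. \<forall>z\<in>frontier unit_square. h z = \<alpha> z) (top_of_set unit_square) X \<alpha> \<gamma>"
    if "(\<alpha>, \<beta>) \<in> homotopy_rel_boundary X" for \<alpha> \<beta> and \<gamma> :: "real \<times> real \<Rightarrow> 'a"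
    using homotopy_rel_boundary_frontier[OF that] by simp
  show "sym (homotopy_rel_boundary X)"
  proof (rule symI)
    fix \<alpha> \<beta> assume h: "(\<alpha>, \<beta>) \<in> homotopy_rel_boundary X"
    then show "(\<beta>, \<alpha>) \<in> homotopy_rel_boundary X"
      using *[OF h, of \<beta>] by (auto simp: homotopy_rel_boundary_def intro: homotopic_with_symD)
  qed
  show "trans (homotopy_rel_boundary X)"
  proof (rule transI)
    fix \<alpha> \<beta> \<gamma>
    assume h: "(\<alpha>, \<beta>) \<in> homotopy_rel_boundary X" and h': "(\<beta>, \<gamma>) \<in> homotopy_rel_boundary X"
    have "homotopic_with (\<lambda>h. \<forall>z\<in>frontier unit_square. h z = \<alpha> z) (top_of_set unit_square) X \<beta> \<gamma>"
      using h' homotopy_rel_boundary_frontier[OF h] by (simp add: homotopy_rel_boundary_def)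
    then show "(\<alpha>, \<gamma>) \<in> homotopy_rel_boundary X"
      using h h' by (auto simp: homotopy_rel_boundary_def intro: homotopic_with_trans)
  qed
qed

text \<open>The straight line from \<open>a z\<close> to \<open>b z\<close> stays in
  \<open>K\<close> by convexity and is constant over the frontier, where its ends coincide.
  Composing it with \<gamma> gives the homotopy.\<close>

lemma homotopic_reparam:
  fixes a b :: "real \<times> real \<Rightarrow> 'b::real_normed_vector"
  assumes K: "convex K" "continuous_map (top_of_set K) X \<gamma>"
    and a: "continuous_on unit_square a" "\<And>z. z \<in> unit_square \<Longrightarrow> a z \<in> K"
    and b: "continuous_on unit_square b" "\<And>z. z \<in> unit_square \<Longrightarrow> b z \<in> K"
    and ab: "\<And>z. z \<in> frontier unit_square \<Longrightarrow> a z = b z"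
    and f: "f \<in> extensional unit_square" "\<And>z. z \<in> unit_square \<Longrightarrow> f z = \<gamma> (a z)"
    and g: "g \<in> extensional unit_square" "\<And>z. z \<in> unit_square \<Longrightarrow> g z = \<gamma> (b z)"
  shows "(f, g) \<in> homotopy_rel_boundary X"
proof (rule homotopy_rel_boundaryI)
  let ?r = "\<lambda>(s::real, z). (1 - s) *\<^sub>R a z + s *\<^sub>R b z"
  show "f \<in> square_maps X" "g \<in> square_maps X"
    unfolding square_maps_def using f g continuous_map_reparam[OF K(2) a] continuous_map_reparam[OF K(2) b]
    by auto
  have "continuous_on ({0..1} \<times> unit_square) (\<lambda>x. c (snd x))"
    if "continuous_on unit_square c" for c :: "real \<times> real \<Rightarrow> 'b"
    by (rule continuous_on_compose2[OF that]) (auto intro!: continuous_intros)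
  then have "continuous_on ({0..1} \<times> unit_square) ?r"
    using a b unfolding case_prod_unfold by (intro continuous_intros) auto
  moreover have "?r x \<in> K" if "x \<in> {0..1} \<times> unit_square" for x
    using that convexD[OF K(1) a(2) b(2), of "snd x" "snd x" "1 - fst x" "fst x"] by auto
  ultimately show "continuous_map (top_of_set ({0..1::real} \<times> unit_square)) X (\<lambda>x. \<gamma> (?r x))"
    by (rule continuous_map_reparam[OF K(2)]) auto
  fix s :: real and z :: "real \<times> real" assume "z \<in> frontier unit_square"
  then show "\<gamma> (?r (s, z)) = f z"
    using ab[of z] f(2)[of z] frontier_unit_square_subset by (simp add: algebra_simps)
qed (use f g in auto)

corollary homotopic_reparam_square:
  assumes "f \<in> square_maps X"
    and a: "continuous_on unit_square a" "\<And>z. z \<in> unit_square \<Longrightarrow> a z \<in> unit_square"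
    and b: "continuous_on unit_square b" "\<And>z. z \<in> unit_square \<Longrightarrow> b z \<in> unit_square"
    and "\<And>z. z \<in> frontier unit_square \<Longrightarrow> a z = b z"
    and "g \<in> extensional unit_square" "\<And>z. z \<in> unit_square \<Longrightarrow> g z = f (a z)"
    and "h \<in> extensional unit_square" "\<And>z. z \<in> unit_square \<Longrightarrow> h z = f (b z)"
  shows "(g, h) \<in> homotopy_rel_boundary X"
  by (rule homotopic_reparam[of unit_square X f a b])
    (use assms in \<open>auto simp: square_maps_def intro: convex_Times\<close>)

section \<open>Horizontal composition of maps\<close>

lemma edges_cong:
  assumes "\<And>z. z \<in> frontier unit_square \<Longrightarrow> f z = g z"
  shows "edge_u f = edge_u g" "edge_v f = edge_v g" "edge_u' f = edge_u' g" "edge_v' f = edge_v' g"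
  unfolding edge_u_def edge_v_def edge_u'_def edge_v'_def
  by (auto simp: frontier_unit_square intro!: restrict_ext assms)

definition hor_composable :: "(real \<times> real \<Rightarrow> 'a) \<Rightarrow> (real \<times> real \<Rightarrow> 'a) \<Rightarrow> bool" where
  "hor_composable f' f \<longleftrightarrow> edge_u f' = edge_u' f \<and> edge_v f' = edge_v' f"

lemma hor_composableD:
  assumes "hor_composable f' f" "r \<in> {0..1}"
  shows "f' (r, 0) = f (1, 1 - r)" "f' (0, r) = f (1 - r, 1)"
proof -
  have "edge_u f' r = edge_u' f r" "edge_v f' r = edge_v' f r"
    using assms by (simp_all add: hor_composable_def)
  then show "f' (r, 0) = f (1, 1 - r)" "f' (0, r) = f (1 - r, 1)"
    using assms(2) by (simp_all add: edge_u_def edge_v_def edge_u'_def edge_v'_def)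
qed

lemma hcomp_map_lower:
  assumes "(x, y) \<in> unit_square" "x + y \<le> 1"
  shows "hcomp_map f' f (x, y) = f (x + min x y, y + min x y)"
  using assms by (auto simp: hcomp_map_def min_def add.commute)

text \<open>On the antidiagonal the definition reads \<open>f\<close> while this formula reads
  \<open>f'\<close>; \<open>hor_composable\<close> glues the target edges of \<open>f\<close> to the
  source edges of \<open>f'\<close> there. Beyond it, two cases merge into one displacement by
  \<open>max x y - 1\<close> along (1, 1).\<close>

lemma hcomp_map_upper:
  assumes "hor_composable f' f" "(x, y) \<in> unit_square" "x + y \<ge> 1"
  shows "hcomp_map f' f (x, y) = f' (x + max x y - 1, y + max x y - 1)"
proof (cases "x + y = 1")
  case True
  then have y: "y = 1 - x"
    by simp
  show ?thesis
  proof (cases "x \<le> y")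
    case x: True
    then show ?thesis
      using assms y hor_composableD(2)[OF assms(1), of "1 - 2 * x"]
      by (simp add: hcomp_map_lower min_def max_def)
  next
    case False
    then show ?thesis
      using assms y hor_composableD(1)[OF assms(1), of "2 * x - 1"]
      by (simp add: hcomp_map_lower min_def max_def)
  qed
next
  case False
  then show ?thesis
    using assms by (auto simp: hcomp_map_def max_def algebra_simps)
qed

text \<open>On the frontier \<open>min x y = 0\<close> if \<open>x + y \<le> 1\<close> and
  \<open>max x y = 1\<close> otherwise, so the displacement vanishes in either half.\<close>

lemma hcomp_map_frontier:
  assumes "(x, y) \<in> frontier unit_square"
  shows "hcomp_map f' f (x, y) = (if x + y \<le> 1 then f (x, y) else f' (x, y))"
  using assms by (auto simp: hcomp_map_def frontier_unit_square)

lemma edges_hcomp_map: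
  assumes "hor_composable f' f"
  shows "edge_u (hcomp_map f' f) = edge_u f" "edge_v (hcomp_map f' f) = edge_v f"
    "edge_u' (hcomp_map f' f) = edge_u' f'" "edge_v' (hcomp_map f' f) = edge_v' f'"
  \<comment> \<open>At the corners (1, 0) and (0, 1) the composite takes its value from
    \<open>f\<close>, although they also belong to the target edges of \<open>f'\<close>;
    composability identifies the values.\<close>
  using hor_composableD[OF assms, of 0] hor_composableD[OF assms, of 1]
  unfolding edge_u_def edge_v_def edge_u'_def edge_v'_def
  by (auto simp: frontier_unit_square hcomp_map_frontier intro!: restrict_ext)

text \<open>The parameter \<open>s\<close> makes one proof serve twice: constant families give
  continuity of a composite, and a pair of homotopies gives a homotopy of composites.\<close>

lemma continuous_hcomp_map_family:
  fixes F' F :: "real \<times> real \<times> real \<Rightarrow> 'a"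
  assumes F': "continuous_map (top_of_set ({0..1} \<times> unit_square)) X F'"
    and F: "continuous_map (top_of_set ({0..1} \<times> unit_square)) X F"
    and comp: "\<And>s. s \<in> {0..1} \<Longrightarrow> hor_composable (\<lambda>z. F' (s, z)) (\<lambda>z. F (s, z))"
  shows "continuous_map (top_of_set ({0..1} \<times> unit_square)) X
           (\<lambda>(s, z). hcomp_map (\<lambda>z. F' (s, z)) (\<lambda>z. F (s, z)) z)"
proof -
  let ?W = "{0..1::real} \<times> (unit_square :: (real \<times> real) set)"
  let ?h = "\<lambda>(s, z). hcomp_map (\<lambda>z. F' (s, z)) (\<lambda>z. F (s, z)) z"
  \<comment> \<open>The conditional with equal branches introduces two closed halves, on which
    \<open>?h\<close> is a reparametrisation of \<open>F\<close> and of \<open>F'\<close>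
    respectively.\<close>
  have "continuous_map (top_of_set ?W) X
      (\<lambda>w. if fst (snd w) + snd (snd w) \<le> 1 then ?h w else ?h w)"
  proof (rule continuous_map_paste_le)
    show "continuous_map (top_of_set {w \<in> ?W. fst (snd w) + snd (snd w) \<le> 1}) X ?h"
      by (rule continuous_map_reparam[OF F, where r = "\<lambda>(s, x, y). (s, x + min x y, y + min x y)"])
        (auto simp: case_prod_unfold hcomp_map_lower intro!: continuous_intros)
    show "continuous_map (top_of_set {w \<in> ?W. 1 \<le> fst (snd w) + snd (snd w)}) X ?h"
      by (rule continuous_map_reparam[OF F',
            where r = "\<lambda>(s, x, y). (s, x + max x y - 1, y + max x y - 1)"])
        (auto simp: case_prod_unfold hcomp_map_upper[OF comp] intro!: continuous_intros)
  qed (auto intro!: continuous_intros)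
  then show ?thesis
    by simp
qed

lemma continuous_map_family_iff:
  "continuous_map (top_of_set ({0..1::real} \<times> unit_square)) X (\<lambda>w. f (snd w)) \<longleftrightarrow>
   continuous_map (top_of_set unit_square) X f" (is "?L \<longleftrightarrow> ?R")
proof
  assume ?L
  then show ?R
    by (rule continuous_map_reparam[where r = "\<lambda>z. (0, z)"]) (auto intro!: continuous_intros)
next
  assume ?R
  then show ?L
    by (rule continuous_map_reparam[where r = snd]) (auto intro!: continuous_intros)
qed

lemma hcomp_map_square_maps:
  assumes "f' \<in> square_maps X" "f \<in> square_maps X" "hor_composable f' f"
  shows "hcomp_map f' f \<in> square_maps X"
proof -
  have "continuous_map (top_of_set unit_square) X (hcomp_map f' f)"
    using continuous_hcomp_map_family[of X "\<lambda>w. f' (snd w)" "\<lambda>w. f (snd w)"] assms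
    by (simp add: continuous_map_family_iff square_maps_def case_prod_unfold)
  then show ?thesis
    by (simp add: square_maps_def hcomp_map_def)
qed

lemma hor_composable_cong:
  assumes "(f', g') \<in> homotopy_rel_boundary X" "(f, g) \<in> homotopy_rel_boundary X"
  shows "hor_composable g' g \<longleftrightarrow> hor_composable f' f"
  unfolding hor_composable_def
  using edges_cong[OF homotopy_rel_boundary_frontier[OF assms(1)]]
    edges_cong[OF homotopy_rel_boundary_frontier[OF assms(2)]] by simp

text \<open>Homotopies rel boundary are constant on the edges, so they stay composable at every time
  and can be composed timewise.\<close>

lemma hcomp_map_homotopic:
  assumes f': "(f', g') \<in> homotopy_rel_boundary X" and f: "(f, g) \<in> homotopy_rel_boundary X"
    and comp: "hor_composable f' f"
  shows "(hcomp_map f' f, hcomp_map g' g) \<in> homotopy_rel_boundary X"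
proof -
  obtain H' where H': "continuous_map (top_of_set ({0..1::real} \<times> unit_square)) X H'"
    "\<And>z. z \<in> unit_square \<Longrightarrow> H' (0, z) = f' z" "\<And>z. z \<in> unit_square \<Longrightarrow> H' (1, z) = g' z"
    "\<And>s z. \<lbrakk>s \<in> {0..1}; z \<in> frontier unit_square\<rbrakk> \<Longrightarrow> H' (s, z) = f' z"
    by (rule homotopy_rel_boundaryE[OF f']) blast
  obtain H where H: "continuous_map (top_of_set ({0..1::real} \<times> unit_square)) X H"
    "\<And>z. z \<in> unit_square \<Longrightarrow> H (0, z) = f z" "\<And>z. z \<in> unit_square \<Longrightarrow> H (1, z) = g z"
    "\<And>s z. \<lbrakk>s \<in> {0..1}; z \<in> frontier unit_square\<rbrakk> \<Longrightarrow> H (s, z) = f z"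
    by (rule homotopy_rel_boundaryE[OF f]) blast
  have compH: "hor_composable (\<lambda>z. H' (s, z)) (\<lambda>z. H (s, z))" if "s \<in> {0..1}" for s
    using comp edges_cong[OF H'(4)[OF that]] edges_cong[OF H(4)[OF that]]
    by (simp add: hor_composable_def)
  have compg: "hor_composable g' g"
    using comp hor_composable_cong[OF f' f] by simp
  have sq: "f' \<in> square_maps X" "f \<in> square_maps X" "g' \<in> square_maps X" "g \<in> square_maps X"
    using f' f by (auto simp: homotopy_rel_boundary_def)
  have cong: "hcomp_map p' p z = hcomp_map q' q z"
    if "\<And>z. z \<in> unit_square \<Longrightarrow> p' z = q' z" "\<And>z. z \<in> unit_square \<Longrightarrow> p z = q z" "z \<in> unit_square"
    for p' p q' q :: "real \<times> real \<Rightarrow> 'a" and z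
    using that by (auto simp: hcomp_map_def)
  show ?thesis
  proof (rule homotopy_rel_boundaryI)
    show "continuous_map (top_of_set ({0..1} \<times> unit_square)) X
           (\<lambda>(s, z). hcomp_map (\<lambda>z. H' (s, z)) (\<lambda>z. H (s, z)) z)"
      by (rule continuous_hcomp_map_family[OF H'(1) H(1) compH])
    show "hcomp_map f' f \<in> square_maps X" "hcomp_map g' g \<in> square_maps X"
      using sq comp compg by (auto intro: hcomp_map_square_maps)
    show "(case (0, z) of (s, z) \<Rightarrow> hcomp_map (\<lambda>z. H' (s, z)) (\<lambda>z. H (s, z)) z) = hcomp_map f' f z"
      "(case (1, z) of (s, z) \<Rightarrow> hcomp_map (\<lambda>z. H' (s, z)) (\<lambda>z. H (s, z)) z) = hcomp_map g' g z"
      if "z \<in> unit_square" for z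
      unfolding prod.case using that by (rule cong[rotated 2]; simp only: H H')+
    fix s :: real and z :: "real \<times> real" assume "s \<in> {0..1}" "z \<in> frontier unit_square"
    then show "(case (s, z) of (s, z) \<Rightarrow> hcomp_map (\<lambda>z. H' (s, z)) (\<lambda>z. H (s, z)) z)
        = hcomp_map f' f z"
      by (cases z) (simp add: hcomp_map_frontier H H')
  qed
qed

section \<open>The horizontal groupoid laws for maps\<close>

text \<open>\<open>c\<close> and \<open>d\<close> are displacements along (1, 1), and the bounds say
  exactly that the displaced point remains in the square. All horizontal laws below are
  instances.\<close>

lemma homotopic_slide:
  assumes "f \<in> square_maps X"
    and c: "continuous_on unit_square c"
      "\<And>x y. (x, y) \<in> unit_square \<Longrightarrow> - min x y \<le> c (x, y) \<and> c (x, y) \<le> 1 - max x y"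
    and d: "continuous_on unit_square d"
      "\<And>x y. (x, y) \<in> unit_square \<Longrightarrow> - min x y \<le> d (x, y) \<and> d (x, y) \<le> 1 - max x y"
    and cd: "\<And>z. z \<in> frontier unit_square \<Longrightarrow> c z = d z"
    and "g \<in> extensional unit_square"
      "\<And>x y. (x, y) \<in> unit_square \<Longrightarrow> g (x, y) = f (x + c (x, y), y + c (x, y))"
    and "h \<in> extensional unit_square"
      "\<And>x y. (x, y) \<in> unit_square \<Longrightarrow> h (x, y) = f (x + d (x, y), y + d (x, y))"
  shows "(g, h) \<in> homotopy_rel_boundary X"
proof -
  have slide: "(x + e (x, y), y + e (x, y)) \<in> unit_square"
    if "(x, y) \<in> unit_square" "- min x y \<le> e (x, y) \<and> e (x, y) \<le> 1 - max x y"
    for x y :: real and e :: "real \<times> real \<Rightarrow> real"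
    using that by (auto simp: min_def max_def split: if_splits)
  show ?thesis
  proof (rule homotopic_reparam_square[OF assms(1),
        where a = "\<lambda>z. (fst z + c z, snd z + c z)" and b = "\<lambda>z. (fst z + d z, snd z + d z)"])
    fix z :: "real \<times> real" assume "z \<in> unit_square"
    then show "(fst z + c z, snd z + c z) \<in> unit_square" "(fst z + d z, snd z + d z) \<in> unit_square"
      using slide[of "fst z" "snd z" c] slide[of "fst z" "snd z" d] c(2)[of "fst z" "snd z"]
        d(2)[of "fst z" "snd z"] by auto
  qed (use assms in \<open>auto intro!: continuous_intros\<close>)
qed

lemma hcomp_map_extensional: "hcomp_map f' f \<in> extensional unit_square"
  by (simp add: hcomp_map_def)

lemma hid_map_extensional: "hid_map u v \<in> extensional unit_square"
  by (simp add: hid_map_def)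

lemma hcomp_map_assoc:
  assumes f: "f \<in> square_maps X" and g: "g \<in> square_maps X" and h: "h \<in> square_maps X"
    and fg: "hor_composable f g" and gh: "hor_composable g h"
  shows "(hcomp_map (hcomp_map f g) h, hcomp_map f (hcomp_map g h)) \<in> homotopy_rel_boundary X"
proof -
  have fg_h: "hor_composable (hcomp_map f g) h" and f_gh: "hor_composable f (hcomp_map g h)"
    using fg gh edges_hcomp_map[OF fg] edges_hcomp_map[OF gh] by (simp_all add: hor_composable_def)
  have sq: "hcomp_map (hcomp_map f g) h \<in> square_maps X"
    by (intro hcomp_map_square_maps f g h fg fg_h)
  \<comment> \<open>Put L = 1 - |y - x| and m = \<open>min x y\<close>. The left bracketing changes
    squares at L/2 and 3L/4, the right one at L/4 and L/2. The piecewise linear map of [0, L] that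
    carries the latter breakpoints to the former displaces m by m, then by L/4, then by (L - m)/2.
    This displacement is concave, hence the minimum of the three.\<close>
  let ?d = "\<lambda>(x, y). min (min x y) (min ((1 - \<bar>y - x\<bar>) / 4) ((1 - \<bar>y - x\<bar> - min x y) / 2))"
  show ?thesis
  proof (rule homotopic_slide[OF sq, where c = "\<lambda>_. 0" and d = ?d])
    show "continuous_on unit_square ?d"
      unfolding case_prod_unfold by (intro continuous_intros) auto
    show "- min x y \<le> ?d (x, y) \<and> ?d (x, y) \<le> 1 - max x y" if "(x, y) \<in> unit_square" for x y
      using that by (auto simp: min_def max_def abs_if field_simps)
    show "0 = ?d z" if "z \<in> frontier unit_square" for z
      using that by (cases z) (auto simp: frontier_unit_square min_def abs_if field_simps)
    fix x y :: real assume xy: "(x, y) \<in> unit_square"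
    \<comment> \<open>On either side of the diagonal, the three intervals between the breakpoints:
      the inequalities say m \<le> L/4, then L/4 \<le> m \<le> L/2, then m \<ge> L/2.\<close>
    consider "x \<le> y" "x + y + 2 * x \<le> 1" | "x \<le> y" "x + y \<le> 1" "x + y + 2 * x \<ge> 1" | "x \<le> y" "x + y \<ge> 1"
      | "y \<le> x" "x + y + 2 * y \<le> 1" | "y \<le> x" "x + y \<le> 1" "x + y + 2 * y \<ge> 1" | "y \<le> x" "x + y \<ge> 1"
      by linarith
    then show "hcomp_map f (hcomp_map g h) (x, y)
        = hcomp_map (hcomp_map f g) h (x + ?d (x, y), y + ?d (x, y))"
    proof cases
      case 1
      then have "?d (x, y) = x"
        using xy by (auto simp: min_def)
      then show ?thesis
        using xy 1 by (simp add: hcomp_map_lower)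
    next
      case 2
      define e where "e = (1 - (y - x)) / 4"
      then have y: "y = 1 + x - 4 * e"
        by simp
      have "?d (x, y) = e"
        using xy 2 by (auto simp: min_def e_def)
      then show ?thesis
        using xy 2 unfolding y
        by (simp add: hcomp_map_lower hcomp_map_upper[OF fg_h] hcomp_map_upper[OF gh] algebra_simps)
    next
      case 3
      then have "?d (x, y) = (1 - y) / 2"
        using xy by (auto simp: min_def)
      then show ?thesis
        using xy 3 by (simp add: hcomp_map_upper[OF f_gh] hcomp_map_upper[OF fg_h] hcomp_map_upper[OF fg] field_simps)
    next
      case 4
      then have "?d (x, y) = y"
        using xy by (auto simp: min_def)
      then show ?thesis
        using xy 4 by (simp add: hcomp_map_lower)
    next
      case 5
      define e where "e = (1 - (x - y)) / 4"
      then have x: "x = 1 + y - 4 * e"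
        by simp
      have "?d (x, y) = e"
        using xy 5 by (auto simp: min_def e_def)
      then show ?thesis
        using xy 5 unfolding x
        by (simp add: hcomp_map_lower hcomp_map_upper[OF fg_h] hcomp_map_upper[OF gh] algebra_simps)
    next
      case 6
      then have "?d (x, y) = (1 - x) / 2"
        using xy by (auto simp: min_def)
      then show ?thesis
        using xy 6 by (simp add: hcomp_map_upper[OF f_gh] hcomp_map_upper[OF fg_h] hcomp_map_upper[OF fg] field_simps)
    qed
  qed (auto simp: hcomp_map_extensional)
qed

text \<open>The identity squares on the source and target of \<open>f\<close> are \<open>f\<close>
  with each segment collapsed to its first or last point. They thereby become slides of
  \<open>f\<close> itself, as the unit and inverse laws require.\<close>

lemma hid_map_edges:
  assumes "(x, y) \<in> unit_square"
  shows "hid_map (edge_u f) (edge_v f) (x, y) = f (x - min x y, y - min x y)"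
    "hid_map (edge_u' f) (edge_v' f) (x, y) = f (x + (1 - max x y), y + (1 - max x y))"
  using assms
  by (auto simp: hid_map_def edge_u_def edge_v_def edge_u'_def edge_v'_def min_def max_def algebra_simps)

lemma hid_map_square_maps:
  assumes "u \<in> paths X" "v \<in> paths X" "u 0 = v 0"
  shows "hid_map u v \<in> square_maps X"
proof -
  have uv: "continuous_map (top_of_set {0..1}) X u" "continuous_map (top_of_set {0..1}) X v"
    using assms by (auto simp: paths_def pathin_def)
  have "continuous_map (top_of_set unit_square) X
      (\<lambda>z. if fst z \<le> snd z then v (snd z - fst z) else u (fst z - snd z))"
  proof (rule continuous_map_paste_le)
    show "continuous_map (top_of_set {z \<in> unit_square. fst z \<le> snd z}) X (\<lambda>z. v (snd z - fst z))"
      by (rule continuous_map_reparam[OF uv(2), where r = "\<lambda>z. snd z - fst z"])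
        (auto intro!: continuous_intros)
    show "continuous_map (top_of_set {z \<in> unit_square. snd z \<le> fst z}) X (\<lambda>z. u (fst z - snd z))"
      by (rule continuous_map_reparam[OF uv(1), where r = "\<lambda>z. fst z - snd z"])
        (auto intro!: continuous_intros)
  qed (use assms in \<open>auto intro!: continuous_intros\<close>)
  from continuous_map_restrict[OF this] show ?thesis
    by (simp add: square_maps_def hid_map_def case_prod_unfold)
qed

lemma edges_hid_map:
  assumes "u \<in> paths X" "v \<in> paths X" "u 0 = v 0"
  shows "edge_u (hid_map u v) = u" "edge_v (hid_map u v) = v"
    "edge_u' (hid_map u v) = u" "edge_v' (hid_map u v) = v"
proof -
  have "u \<in> extensional {0..1}" "v \<in> extensional {0..1}"
    using assms by (auto simp: paths_def)
  then show "edge_u (hid_map u v) = u" "edge_v (hid_map u v) = v"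
    "edge_u' (hid_map u v) = u" "edge_v' (hid_map u v) = v"
    using assms(3)
    by (auto simp: edge_u_def edge_v_def edge_u'_def edge_v'_def hid_map_def fun_eq_iff
        extensional_def restrict_def intro: antisym)
qed

lemma edges_in_paths:
  assumes "f \<in> square_maps X"
  shows "edge_u f \<in> paths X" "edge_v f \<in> paths X" "edge_u' f \<in> paths X" "edge_v' f \<in> paths X"
proof -
  have f: "continuous_map (top_of_set unit_square) X f"
    using assms by (simp add: square_maps_def)
  have path: "restrict (\<lambda>t. f (r t)) {0..1} \<in> paths X"
    if "continuous_on {0..1} r" "\<And>t. t \<in> {0..1} \<Longrightarrow> r t \<in> unit_square" for r
    using continuous_map_restrict[OF continuous_map_reparam[OF f that refl]]
    by (simp add: paths_def pathin_def)
  then show "edge_u f \<in> paths X" "edge_v f \<in> paths X" "edge_u' f \<in> paths X" "edge_v' f \<in> paths X"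
    unfolding edge_u_def edge_v_def edge_u'_def edge_v'_def
    by - (rule path; auto intro!: continuous_intros)+
qed

lemma edges_endpoints:
  "edge_u f 0 = edge_v f 0" "edge_u' f 0 = edge_v' f 0"
  "edge_u f 1 = edge_u' f 1" "edge_v f 1 = edge_v' f 1"
  by (simp_all add: edge_u_def edge_v_def edge_u'_def edge_v'_def)

lemma hor_composable_hid_map:
  assumes "f \<in> square_maps X"
  shows "hor_composable f (hid_map (edge_u f) (edge_v f))"
    "hor_composable (hid_map (edge_u' f) (edge_v' f)) f"
  using edges_hid_map[OF edges_in_paths(1)[OF assms] edges_in_paths(2)[OF assms] edges_endpoints(1)]
    edges_hid_map[OF edges_in_paths(3)[OF assms] edges_in_paths(4)[OF assms] edges_endpoints(2)]
  by (simp_all add: hor_composable_def)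

text \<open>On each segment the composite waits at the initial point and then runs through
  \<open>f\<close> at double speed. With m = \<open>min x y\<close> the displacements are -m and m -
  L = \<open>max x y - 1\<close>; they cross at the midpoint, so \<open>?c\<close> is their
  maximum.\<close>

lemma hcomp_map_hid_right:
  assumes f: "f \<in> square_maps X"
  shows "(hcomp_map f (hid_map (edge_u f) (edge_v f)), f) \<in> homotopy_rel_boundary X"
proof (rule homotopic_slide[OF f])
  let ?c = "\<lambda>(x, y). max (- min x y) (max x y - 1)"
  show "continuous_on unit_square ?c"
    unfolding case_prod_unfold by (intro continuous_intros)
  show "- min x y \<le> ?c (x, y) \<and> ?c (x, y) \<le> 1 - max x y" if "(x, y) \<in> unit_square" for x y
    using that by (auto simp: min_def max_def)
  show "?c z = 0" if "z \<in> frontier unit_square" for z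
    using that by (cases z) (auto simp: frontier_unit_square min_def max_def)
  fix x y :: real assume xy: "(x, y) \<in> unit_square"
  show "hcomp_map f (hid_map (edge_u f) (edge_v f)) (x, y) = f (x + ?c (x, y), y + ?c (x, y))"
  proof (cases "x + y \<le> 1")
    case True
    then have "hcomp_map f (hid_map (edge_u f) (edge_v f)) (x, y) = f (x - min x y, y - min x y)"
      using xy by (subst hcomp_map_lower) (auto simp: hid_map_edges min_def)
    moreover have "?c (x, y) = - min x y"
      using True by (simp add: min_def max_def)
    ultimately show ?thesis
      by simp
  next
    case False
    then have "?c (x, y) = max x y - 1"
      by (simp add: min_def max_def)
    then show ?thesis
      using False xy by (simp add: hcomp_map_upper[OF hor_composable_hid_map(1)[OF f]] add_diff_eq)
  qed
qed (use f in \<open>auto simp: hcomp_map_extensional square_maps_def\<close>)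

text \<open>Here the segment is run through at double speed before resting at its end. The
  displacements m and L - m form a concave function, hence the minimum.\<close>

lemma hcomp_map_hid_left:
  assumes f: "f \<in> square_maps X"
  shows "(hcomp_map (hid_map (edge_u' f) (edge_v' f)) f, f) \<in> homotopy_rel_boundary X"
proof (rule homotopic_slide[OF f])
  let ?c = "\<lambda>(x, y). min (min x y) (1 - max x y)"
  show "continuous_on unit_square ?c"
    unfolding case_prod_unfold by (intro continuous_intros)
  show "- min x y \<le> ?c (x, y) \<and> ?c (x, y) \<le> 1 - max x y" if "(x, y) \<in> unit_square" for x y
    using that by (auto simp: min_def max_def)
  show "?c z = 0" if "z \<in> frontier unit_square" for z
    using that by (cases z) (auto simp: frontier_unit_square min_def max_def)
  fix x y :: real assume xy: "(x, y) \<in> unit_square"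
  show "hcomp_map (hid_map (edge_u' f) (edge_v' f)) f (x, y) = f (x + ?c (x, y), y + ?c (x, y))"
  proof (cases "x + y \<le> 1")
    case True
    then have "?c (x, y) = min x y"
      by (simp add: min_def max_def)
    then show ?thesis
      using True xy by (simp add: hcomp_map_lower)
  next
    case False
    then have "hcomp_map (hid_map (edge_u' f) (edge_v' f)) f (x, y) = f (x + (1 - max x y), y + (1 - max x y))"
      using xy
      by (subst hcomp_map_upper[OF hor_composable_hid_map(2)[OF f]])
        (auto simp: hid_map_edges max_def algebra_simps)
    moreover have "?c (x, y) = 1 - max x y"
      using False by (simp add: min_def max_def)
    ultimately show ?thesis
      by simp
  qed
qed (use f in \<open>auto simp: hcomp_map_extensional square_maps_def\<close>)

text \<open>Reflection in the antidiagonal preserves \<open>y - x\<close> and sends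
  \<open>min x y\<close> to \<open>1 - max x y\<close>, so it reverses every segment.\<close>

definition hinv_map :: "(real \<times> real \<Rightarrow> 'a) \<Rightarrow> real \<times> real \<Rightarrow> 'a" where
  "hinv_map f = (\<lambda>(x, y)\<in>unit_square. f (1 - y, 1 - x))"

lemma hinv_map_apply: "(x, y) \<in> unit_square \<Longrightarrow> hinv_map f (x, y) = f (1 - y, 1 - x)"
  by (simp add: hinv_map_def)

lemma hinv_map_square_maps:
  assumes "f \<in> square_maps X"
  shows "hinv_map f \<in> square_maps X"
proof -
  have f: "continuous_map (top_of_set unit_square) X f"
    using assms by (simp add: square_maps_def)
  have "continuous_map (top_of_set unit_square) X (hinv_map f)"
    by (rule continuous_map_reparam[OF f, where r = "\<lambda>z. (1 - snd z, 1 - fst z)"])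
      (auto simp: hinv_map_def intro!: continuous_intros)
  then show ?thesis
    by (simp add: square_maps_def hinv_map_def)
qed

lemma edges_hinv_map:
  "edge_u (hinv_map f) = edge_u' f" "edge_v (hinv_map f) = edge_v' f"
  "edge_u' (hinv_map f) = edge_u f" "edge_v' (hinv_map f) = edge_v f"
  unfolding edge_u_def edge_v_def edge_u'_def edge_v'_def
  by (auto simp: hinv_map_def intro!: restrict_ext)

lemma hor_composable_hinv_map: "hor_composable (hinv_map f) f" "hor_composable f (hinv_map f)"
  by (simp_all add: hor_composable_def edges_hinv_map)

text \<open>Each segment is run forwards and back, at positions 2m and then 2(L - m), where m =
  \<open>min x y\<close>; subtracting m gives \<open>?c\<close>. The straight line to
  \<open>?d\<close> contracts this loop to its base point, the start of the segment.\<close>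

lemma hcomp_map_hinv_left:
  assumes f: "f \<in> square_maps X"
  shows "(hcomp_map (hinv_map f) f, hid_map (edge_u f) (edge_v f)) \<in> homotopy_rel_boundary X"
proof (rule homotopic_slide[OF f])
  let ?c = "\<lambda>(x, y). min (min x y) (2 - 2 * max x y - min x y)" and ?d = "\<lambda>(x, y). - min x y"
  show "continuous_on unit_square ?c" "continuous_on unit_square ?d"
    unfolding case_prod_unfold by (intro continuous_intros)+
  show "- min x y \<le> ?c (x, y) \<and> ?c (x, y) \<le> 1 - max x y"
    "- min x y \<le> ?d (x, y) \<and> ?d (x, y) \<le> 1 - max x y" if "(x, y) \<in> unit_square" for x y
    using that by (auto simp: min_def max_def)
  show "?c z = ?d z" if "z \<in> frontier unit_square" for z
    using that by (cases z) (auto simp: frontier_unit_square min_def max_def)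
  fix x y :: real assume xy: "(x, y) \<in> unit_square"
  show "hid_map (edge_u f) (edge_v f) (x, y) = f (x + ?d (x, y), y + ?d (x, y))"
    using xy by (simp add: hid_map_edges)
  show "hcomp_map (hinv_map f) f (x, y) = f (x + ?c (x, y), y + ?c (x, y))"
  proof (cases "x + y \<le> 1")
    case True
    then have "?c (x, y) = min x y"
      by (simp add: min_def max_def)
    then show ?thesis
      using True xy by (simp add: hcomp_map_lower)
  next
    case False
    then have "?c (x, y) = 2 - 2 * max x y - min x y"
      by (simp add: min_def max_def)
    then show ?thesis
      using False xy
      by (auto simp: hcomp_map_upper[OF hor_composable_hinv_map(1)] hinv_map_apply min_def max_def algebra_simps)
  qed
qed (auto simp: hcomp_map_extensional hid_map_extensional)

text \<open>The loop is now based at the end of the segment: its position is L - 2m and then 2m -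
  L.\<close>

lemma hcomp_map_hinv_right:
  assumes f: "f \<in> square_maps X"
  shows "(hcomp_map f (hinv_map f), hid_map (edge_u' f) (edge_v' f)) \<in> homotopy_rel_boundary X"
proof (rule homotopic_slide[OF f])
  let ?c = "\<lambda>(x, y). max (max x y - 1) (1 - max x y - 2 * min x y)" and ?d = "\<lambda>(x, y). 1 - max x y"
  show "continuous_on unit_square ?c" "continuous_on unit_square ?d"
    unfolding case_prod_unfold by (intro continuous_intros)+
  show "- min x y \<le> ?c (x, y) \<and> ?c (x, y) \<le> 1 - max x y"
    "- min x y \<le> ?d (x, y) \<and> ?d (x, y) \<le> 1 - max x y" if "(x, y) \<in> unit_square" for x y
    using that by (auto simp: min_def max_def)
  show "?c z = ?d z" if "z \<in> frontier unit_square" for z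
    using that by (cases z) (auto simp: frontier_unit_square min_def max_def)
  fix x y :: real assume xy: "(x, y) \<in> unit_square"
  show "hid_map (edge_u' f) (edge_v' f) (x, y) = f (x + ?d (x, y), y + ?d (x, y))"
    using xy by (simp add: hid_map_edges)
  show "hcomp_map f (hinv_map f) (x, y) = f (x + ?c (x, y), y + ?c (x, y))"
  proof (cases "x + y \<le> 1")
    case True
    then have "?c (x, y) = 1 - max x y - 2 * min x y"
      by (simp add: min_def max_def)
    then show ?thesis
      using True xy by (auto simp: hcomp_map_lower hinv_map_apply min_def max_def algebra_simps)
  next
    case False
    then have "?c (x, y) = max x y - 1"
      by (simp add: min_def max_def)
    then show ?thesis
      using False xy by (simp add: hcomp_map_upper[OF hor_composable_hinv_map(2)] add_diff_eq)
  qed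
qed (auto simp: hcomp_map_extensional hid_map_extensional)

section \<open>Vertical composition as a reflection of horizontal composition\<close>

definition mirror :: "(real \<times> real \<Rightarrow> 'a) \<Rightarrow> real \<times> real \<Rightarrow> 'a" where
  "mirror f = (\<lambda>(x, y)\<in>unit_square. f (1 - x, y))"

definition rev_path :: "(real \<Rightarrow> 'a) \<Rightarrow> real \<Rightarrow> 'a" where
  "rev_path u = (\<lambda>t\<in>{0..1}. u (1 - t))"

lemma mirror_apply: "(x, y) \<in> unit_square \<Longrightarrow> mirror f (x, y) = f (1 - x, y)"
  by (simp add: mirror_def)

lemma mirror_mirror: "f \<in> extensional unit_square \<Longrightarrow> mirror (mirror f) = f"
  by (auto simp: mirror_def fun_eq_iff extensional_def)

lemma mirror_square_maps:
  assumes "f \<in> square_maps X"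
  shows "mirror f \<in> square_maps X"
proof -
  have f: "continuous_map (top_of_set unit_square) X f"
    using assms by (simp add: square_maps_def)
  have "continuous_map (top_of_set unit_square) X (mirror f)"
    by (rule continuous_map_reparam[OF f, where r = "\<lambda>z. (1 - fst z, snd z)"])
      (auto simp: mirror_def intro!: continuous_intros)
  then show ?thesis
    by (simp add: square_maps_def mirror_def)
qed

lemma mirror_homotopic:
  assumes "(f, g) \<in> homotopy_rel_boundary X"
  shows "(mirror f, mirror g) \<in> homotopy_rel_boundary X"
proof -
  obtain H where H: "f \<in> square_maps X" "g \<in> square_maps X"
    "continuous_map (top_of_set ({0..1::real} \<times> unit_square)) X H"
    "\<And>z. z \<in> unit_square \<Longrightarrow> H (0, z) = f z" "\<And>z. z \<in> unit_square \<Longrightarrow> H (1, z) = g z"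
    "\<And>s z. \<lbrakk>s \<in> {0..1}; z \<in> frontier unit_square\<rbrakk> \<Longrightarrow> H (s, z) = f z"
    by (rule homotopy_rel_boundaryE[OF assms]) blast
  show ?thesis
  proof (rule homotopy_rel_boundaryI[OF mirror_square_maps[OF H(1)] mirror_square_maps[OF H(2)]])
    show "continuous_map (top_of_set ({0..1} \<times> unit_square)) X (\<lambda>(s, x, y). H (s, 1 - x, y))"
      by (rule continuous_map_reparam[OF H(3), where r = "\<lambda>(s, x, y). (s, 1 - x, y)"])
        (auto simp: case_prod_unfold intro!: continuous_intros)
    fix z :: "real \<times> real"
    show "(case (0, z) of (s, x, y) \<Rightarrow> H (s, 1 - x, y)) = mirror f z"
      "(case (1, z) of (s, x, y) \<Rightarrow> H (s, 1 - x, y)) = mirror g z" if "z \<in> unit_square"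
      using that H(4,5)[of "(1 - fst z, snd z)"] by (auto simp: mirror_def)
    show "(case (s, z) of (s, x, y) \<Rightarrow> H (s, 1 - x, y)) = mirror f z"
      if "s \<in> {0..1}" "z \<in> frontier unit_square" for s
    proof -
      obtain x y where z: "z = (x, y)"
        by fastforce
      then have "(1 - x, y) \<in> frontier unit_square" "(x, y) \<in> unit_square"
        using that by (auto simp: frontier_unit_square)
      then show ?thesis
        using H(6)[OF that(1), of "(1 - x, y)"] by (simp add: mirror_apply z)
    qed
  qed
qed

text \<open>The reflection reverses all four paths and exchanges the left and right edges. This
  turns vertical source and target into the horizontal ones, and common end points into common
  starting points.\<close>

lemma edges_mirror:
  "edge_u (mirror f) = rev_path (edge_u f)" "edge_v (mirror f) = rev_path (edge_u' f)"
  "edge_u' (mirror f) = rev_path (edge_v f)" "edge_v' (mirror f) = rev_path (edge_v' f)"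
  unfolding edge_u_def edge_v_def edge_u'_def edge_v'_def rev_path_def
  by (auto simp: mirror_def intro!: restrict_ext)

lemma rev_path_rev_path: "u \<in> extensional {0..1} \<Longrightarrow> rev_path (rev_path u) = u"
  by (auto simp: rev_path_def fun_eq_iff extensional_def)

lemma edges_extensional:
  "edge_u f \<in> extensional {0..1}" "edge_v f \<in> extensional {0..1}"
  "edge_u' f \<in> extensional {0..1}" "edge_v' f \<in> extensional {0..1}"
  by (simp_all add: edge_u_def edge_v_def edge_u'_def edge_v'_def)

lemmas rev_path_edges = edges_extensional[THEN rev_path_rev_path]

definition ver_composable :: "(real \<times> real \<Rightarrow> 'a) \<Rightarrow> (real \<times> real \<Rightarrow> 'a) \<Rightarrow> bool" where
  "ver_composable f' f \<longleftrightarrow> edge_u f' = edge_v f \<and> edge_u' f' = edge_v' f"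

lemma hor_composable_mirror: "hor_composable (mirror f') (mirror f) \<longleftrightarrow> ver_composable f' f"
proof -
  have inj: "rev_path p = rev_path q \<longleftrightarrow> p = q"
    if "p \<in> extensional {0..1}" "q \<in> extensional {0..1}" for p q :: "real \<Rightarrow> 'a"
    using that rev_path_rev_path by metis
  show ?thesis
    unfolding hor_composable_def ver_composable_def edges_mirror
    by (simp only: inj edges_extensional)
qed

text \<open>Under the reflection the four cases of the two definitions correspond in the same order,
  so the equation extends to the seams, where that order decides.\<close>

lemma vcomp_map_eq_mirror: "vcomp_map f' f = mirror (hcomp_map (mirror f') (mirror f))"
proof (rule ext, clarify)
  fix x y :: real
  show "vcomp_map f' f (x, y) = mirror (hcomp_map (mirror f') (mirror f)) (x, y)"
  proof (cases "(x, y) \<in> unit_square")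
    case True
    have "hcomp_map (mirror f') (mirror f) (1 - x, y) = vcomp_map f' f (x, y)"
      using True
      by (cases "y \<le> x"; cases "x + y \<le> 1"; cases "x = y"; cases "x + y = 1")
        (simp_all add: hcomp_map_def vcomp_map_def mirror_apply add_diff_eq diff_diff_eq2)
    then show ?thesis
      using True by (simp add: mirror_apply)
  qed (simp only: vcomp_map_def mirror_def restrict_apply if_False)
qed

text \<open>On the antidiagonal \<open>vid_map\<close> reads \<open>u\<close> and the reflected
  \<open>hid_map\<close> reads \<open>u'\<close>, both at their end points; the hypothesis
  reconciles them.\<close>

lemma vid_map_eq_mirror:
  assumes "u 1 = u' 1"
  shows "vid_map u u' = mirror (hid_map (rev_path u) (rev_path u'))"
proof (rule ext, clarify)
  fix x y :: real
  show "vid_map u u' (x, y) = mirror (hid_map (rev_path u) (rev_path u')) (x, y)"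
  proof (cases "(x, y) \<in> unit_square")
    case True
    have "hid_map (rev_path u) (rev_path u') (1 - x, y) = vid_map u u' (x, y)"
      using True assms
      by (cases "x + y < 1"; cases "x + y = 1")
        (simp_all add: hid_map_def vid_map_def rev_path_def add_diff_eq diff_diff_eq2
            diff_diff_eq add.commute)
    then show ?thesis
      using True by (simp add: mirror_apply)
  qed (simp only: vid_map_def mirror_def restrict_apply if_False)
qed

lemma edges_vcomp_map:
  assumes "ver_composable f' f"
  shows "edge_u (vcomp_map f' f) = edge_u f" "edge_u' (vcomp_map f' f) = edge_u' f"
    "edge_v (vcomp_map f' f) = edge_v f'" "edge_v' (vcomp_map f' f) = edge_v' f'"
  using assms unfolding hor_composable_mirror[symmetric]
  by (simp_all add: vcomp_map_eq_mirror edges_mirror edges_hcomp_map rev_path_edges)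

lemma vcomp_map_square_maps:
  assumes "f' \<in> square_maps X" "f \<in> square_maps X" "ver_composable f' f"
  shows "vcomp_map f' f \<in> square_maps X"
  using assms unfolding vcomp_map_eq_mirror
  by (intro mirror_square_maps hcomp_map_square_maps) (simp_all add: hor_composable_mirror)

lemma vcomp_map_homotopic:
  assumes "(f', g') \<in> homotopy_rel_boundary X" "(f, g) \<in> homotopy_rel_boundary X"
    and "ver_composable f' f"
  shows "(vcomp_map f' f, vcomp_map g' g) \<in> homotopy_rel_boundary X"
  using assms unfolding vcomp_map_eq_mirror
  by (intro mirror_homotopic hcomp_map_homotopic) (simp_all add: hor_composable_mirror)

lemma vcomp_map_assoc:
  assumes "f \<in> square_maps X" "g \<in> square_maps X" "h \<in> square_maps X"
    and "ver_composable f g" "ver_composable g h"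
  shows "(vcomp_map (vcomp_map f g) h, vcomp_map f (vcomp_map g h)) \<in> homotopy_rel_boundary X"
  using assms unfolding vcomp_map_eq_mirror mirror_mirror[OF hcomp_map_extensional]
  by (intro mirror_homotopic hcomp_map_assoc mirror_square_maps) (simp_all add: hor_composable_mirror)

lemma rev_path_in_paths:
  assumes "u \<in> paths X"
  shows "rev_path u \<in> paths X"
proof -
  have u: "continuous_map (top_of_set {0..1}) X u"
    using assms by (simp add: paths_def pathin_def)
  have "continuous_map (top_of_set {0..1}) X (rev_path u)"
    by (rule continuous_map_reparam[OF u, where r = "\<lambda>t. 1 - t"])
      (auto simp: rev_path_def intro!: continuous_intros)
  then show ?thesis
    by (simp add: paths_def pathin_def rev_path_def)
qed

lemma rev_path_endpoints: "rev_path u 0 = u 1" "rev_path u 1 = u 0"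
  by (simp_all add: rev_path_def)

lemma vid_map_square_maps:
  assumes "u \<in> paths X" "u' \<in> paths X" "u 1 = u' 1"
  shows "vid_map u u' \<in> square_maps X"
  unfolding vid_map_eq_mirror[of u u', OF assms(3)]
  using assms by (intro mirror_square_maps hid_map_square_maps rev_path_in_paths) (simp_all add: rev_path_endpoints)

lemma edges_vid_map:
  assumes "u \<in> paths X" "u' \<in> paths X" "u 1 = u' 1"
  shows "edge_u (vid_map u u') = u" "edge_v (vid_map u u') = u"
    "edge_u' (vid_map u u') = u'" "edge_v' (vid_map u u') = u'"
proof -
  have "rev_path u 0 = rev_path u' 0" "rev_path (rev_path u) = u" "rev_path (rev_path u') = u'"
    using assms by (simp_all add: rev_path_endpoints rev_path_rev_path paths_def)
  then show "edge_u (vid_map u u') = u" "edge_v (vid_map u u') = u"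
    "edge_u' (vid_map u u') = u'" "edge_v' (vid_map u u') = u'"
    using edges_hid_map[OF rev_path_in_paths[OF assms(1)] rev_path_in_paths[OF assms(2)]]
    by (simp_all add: vid_map_eq_mirror[of u u', OF assms(3)] edges_mirror)
qed

definition vinv_map :: "(real \<times> real \<Rightarrow> 'a) \<Rightarrow> real \<times> real \<Rightarrow> 'a" where
  "vinv_map f = mirror (hinv_map (mirror f))"

lemma vinv_map_square_maps: "f \<in> square_maps X \<Longrightarrow> vinv_map f \<in> square_maps X"
  by (simp add: vinv_map_def mirror_square_maps hinv_map_square_maps)

lemma edges_vinv_map:
  "edge_u (vinv_map f) = edge_v f" "edge_u' (vinv_map f) = edge_v' f"
  "edge_v (vinv_map f) = edge_u f" "edge_v' (vinv_map f) = edge_u' f"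
  by (simp_all add: vinv_map_def edges_mirror edges_hinv_map rev_path_edges)

text \<open>These are the horizontal laws for \<open>mirror f\<close>, reflected back; double
  reflections cancel on extensional maps.\<close>

lemma vertical_groupoid_laws:
  assumes f: "f \<in> square_maps X"
  shows "(vcomp_map f (vid_map (edge_u f) (edge_u' f)), f) \<in> homotopy_rel_boundary X"
    "(vcomp_map (vid_map (edge_v f) (edge_v' f)) f, f) \<in> homotopy_rel_boundary X"
    "(vcomp_map (vinv_map f) f, vid_map (edge_u f) (edge_u' f)) \<in> homotopy_rel_boundary X"
    "(vcomp_map f (vinv_map f), vid_map (edge_v f) (edge_v' f)) \<in> homotopy_rel_boundary X"
proof -
  have ext: "f \<in> extensional unit_square" "hinv_map (mirror f) \<in> extensional unit_square"
    using f by (simp_all add: square_maps_def hinv_map_def)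
  note laws = hcomp_map_hid_right hcomp_map_hid_left hcomp_map_hinv_left hcomp_map_hinv_right
  show "(vcomp_map f (vid_map (edge_u f) (edge_u' f)), f) \<in> homotopy_rel_boundary X"
    "(vcomp_map (vid_map (edge_v f) (edge_v' f)) f, f) \<in> homotopy_rel_boundary X"
    "(vcomp_map (vinv_map f) f, vid_map (edge_u f) (edge_u' f)) \<in> homotopy_rel_boundary X"
    "(vcomp_map f (vinv_map f), vid_map (edge_v f) (edge_v' f)) \<in> homotopy_rel_boundary X"
    using laws[OF mirror_square_maps[OF f], THEN mirror_homotopic]
    unfolding vcomp_map_eq_mirror vinv_map_def
      vid_map_eq_mirror[of "edge_u f" "edge_u' f", OF edges_endpoints(3)]
      vid_map_eq_mirror[of "edge_v f" "edge_v' f", OF edges_endpoints(4)] edges_mirror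
      mirror_mirror[OF ext(1)] mirror_mirror[OF ext(2)] mirror_mirror[OF hid_map_extensional]
    by - assumption+
qed

section \<open>The interchange law for maps\<close>

text \<open>
  The two diagonals cut the unit square into four triangles, on which both composites in the
  interchange law are reparametrisations of the four given squares \<open>\<alpha>\<close> (top), \<open>\<beta>\<close> (left),
  \<open>\<gamma>\<close> (right), \<open>\<delta>\<close> (bottom). Up to the symmetries of the square it is the same reparametrisation
  \<open>T\<close> on all triangles; its arguments are the distances \<open>p = \<bar>x + y - 1\<bar>\<close> and \<open>q = \<bar>y - x\<bar>\<close> from
  the diagonals. The pieces fit together if \<open>T\<close> maps the side \<open>q = 0\<close> into the union of the bottom
  and right edges of \<open>\<beta>\<close>, and the side \<open>p = 0\<close> into that of the top and right edges.
\<close>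

definition quad ::
  "(real \<times> real \<Rightarrow> 'a) \<Rightarrow> (real \<times> real \<Rightarrow> 'a) \<Rightarrow> (real \<times> real \<Rightarrow> 'a) \<Rightarrow> (real \<times> real \<Rightarrow> 'a) \<Rightarrow>
   (real \<times> real \<Rightarrow> real \<times> real) \<Rightarrow> real \<times> real \<Rightarrow> 'a" where
  "quad \<alpha> \<beta> \<gamma> \<delta> T = (\<lambda>(x, y)\<in>unit_square.
     let w = T (\<bar>x + y - 1\<bar>, \<bar>y - x\<bar>) in
     if x + y \<le> 1 then (if x \<le> y then \<beta> w else \<delta> (snd w, fst w))
     else (if x \<le> y then \<alpha> (1 - snd w, 1 - fst w) else \<gamma> (1 - fst w, 1 - snd w)))"

abbreviation diagonal_distances :: "(real \<times> real) set" where
  "diagonal_distances \<equiv> {(p, q). 0 \<le> p \<and> 0 \<le> q \<and> p + q \<le> 1}"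

lemma ver_composableD:
  assumes "ver_composable f' f" "r \<in> {0..1}"
  shows "f' (r, 0) = f (0, r)" "f' (1, 1 - r) = f (1 - r, 1)"
proof -
  have "edge_u f' r = edge_v f r" "edge_u' f' r = edge_v' f r"
    using assms by (simp_all add: ver_composable_def)
  then show "f' (r, 0) = f (0, r)" "f' (1, 1 - r) = f (1 - r, 1)"
    using assms(2) by (simp_all add: edge_u_def edge_v_def edge_u'_def edge_v'_def)
qed

text \<open>Reflection in the antidiagonal takes the right edge to the bottom one and the top edge
  to the left one, with the parametrisations that composability prescribes. Pieces of
  \<open>quad\<close> adjacent across the antidiagonal differ by this reflection.\<close>

lemma hor_composable_sides:
  assumes "hor_composable f' f" "w \<in> unit_square" "fst w = 1 \<or> snd w = 1"
  shows "f' (1 - snd w, 1 - fst w) = f w"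
  using assms(2,3) hor_composableD(1)[OF assms(1), of "1 - snd w"]
    hor_composableD(2)[OF assms(1), of "1 - fst w"]
  by (cases w) auto

text \<open>Transposition has the same role for pieces adjacent across the diagonal.\<close>

lemma ver_composable_sides:
  assumes "ver_composable f' f" "w \<in> unit_square" "fst w = 1 \<or> snd w = 0"
  shows "f' w = f (snd w, fst w)"
  using assms(2,3) ver_composableD(1)[OF assms(1), of "fst w"]
    ver_composableD(2)[OF assms(1), of "1 - snd w"]
  by (cases w) auto

text \<open>The straight line from \<open>T\<close> to \<open>T'\<close> is used on all four
  triangles at once. At \<open>p + q = 1\<close>, which is the frontier, it is constant. For the
  pieces to fit at all times, \<open>T\<close> and \<open>T'\<close> must lie on a common edge at
  each point of a seam, since a segment between different edges would leave their union; this is the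
  form of the disjunctions.\<close>

lemma quad_homotopic:
  assumes sq: "\<alpha> \<in> square_maps X" "\<beta> \<in> square_maps X" "\<gamma> \<in> square_maps X" "\<delta> \<in> square_maps X"
    and comp: "hor_composable \<alpha> \<beta>" "hor_composable \<gamma> \<delta>" "ver_composable \<alpha> \<gamma>" "ver_composable \<beta> \<delta>"
    and T: "continuous_on diagonal_distances T" "T ` diagonal_distances \<subseteq> unit_square"
    and T': "continuous_on diagonal_distances T'" "T' ` diagonal_distances \<subseteq> unit_square"
    and boundary: "\<And>p q. \<lbrakk>0 \<le> p; 0 \<le> q; p + q = 1\<rbrakk> \<Longrightarrow> T (p, q) = T' (p, q)"
    and bottom: "\<And>p. \<lbrakk>0 \<le> p; p \<le> 1\<rbrakk> \<Longrightarrow>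
      fst (T (p, 0)) = 1 \<and> fst (T' (p, 0)) = 1 \<or> snd (T (p, 0)) = 0 \<and> snd (T' (p, 0)) = 0"
    and top: "\<And>q. \<lbrakk>0 \<le> q; q \<le> 1\<rbrakk> \<Longrightarrow>
      fst (T (0, q)) = 1 \<and> fst (T' (0, q)) = 1 \<or> snd (T (0, q)) = 1 \<and> snd (T' (0, q)) = 1"
  shows "(quad \<alpha> \<beta> \<gamma> \<delta> T, quad \<alpha> \<beta> \<gamma> \<delta> T') \<in> homotopy_rel_boundary X"
proof -
  let ?W = "{0..1::real} \<times> (unit_square :: (real \<times> real) set)"
  let ?x = "\<lambda>w::real \<times> real \<times> real. fst (snd w)" and ?y = "\<lambda>w::real \<times> real \<times> real. snd (snd w)"
  define R where "R s v = (1 - s) *\<^sub>R T v + s *\<^sub>R T' v" for s v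
  define r where "r w = R (fst w) (\<bar>?x w + ?y w - 1\<bar>, \<bar>?y w - ?x w\<bar>)" for w
  have dist: "(\<bar>x + y - 1\<bar>, \<bar>y - x\<bar>) \<in> diagonal_distances" if "(x, y) \<in> unit_square" for x y :: real
    using that by (auto simp: abs_if)
  have R: "R s v \<in> unit_square" if "s \<in> {0..1}" "v \<in> diagonal_distances" for s v
  proof -
    have "convex (unit_square :: (real \<times> real) set)"
      by (intro convex_Times) auto
    then show ?thesis
      unfolding R_def using that T(2) T'(2) by (intro convexD) auto
  qed
  then have r: "r w \<in> unit_square" if "w \<in> ?W" for w
    using that dist[of "?x w" "?y w"] unfolding r_def by (cases w) (fastforce simp del: split_paired_All)
  have cont: "continuous_on ?W (\<lambda>w. c (\<bar>?x w + ?y w - 1\<bar>, \<bar>?y w - ?x w\<bar>))"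
    if "continuous_on diagonal_distances c" for c :: "real \<times> real \<Rightarrow> real \<times> real"
  proof (rule continuous_on_compose2[OF that])
    show "continuous_on ?W (\<lambda>w. (\<bar>?x w + ?y w - 1\<bar>, \<bar>?y w - ?x w\<bar>))"
      by (intro continuous_intros)
  qed (use dist in auto)
  have contr: "continuous_on ?W r"
    unfolding r_def R_def by (intro continuous_intros cont T T')
  have rbottom: "fst (r w) = 1 \<or> snd (r w) = 0" if "w \<in> ?W" "?x w = ?y w" for w
    using that bottom[of "\<bar>?x w + ?y w - 1\<bar>"] unfolding r_def R_def by (auto simp: abs_if)
  have rtop: "fst (r w) = 1 \<or> snd (r w) = 1" if "w \<in> ?W" "?x w + ?y w = 1" for w
    using that top[of "\<bar>?y w - ?x w\<bar>"] unfolding r_def R_def by (auto simp: abs_if)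
  have piece: "continuous_map (top_of_set S) X (\<lambda>w. f (m (r w)))"
    if "f \<in> square_maps X" "S \<subseteq> ?W" "continuous_on unit_square m" "m ` unit_square \<subseteq> unit_square" for f m S
  proof (rule continuous_map_reparam[where r = "\<lambda>w. m (r w)"])
    show "continuous_map (top_of_set unit_square) X f"
      using that by (simp add: square_maps_def)
    show "continuous_on S (\<lambda>w. m (r w))"
    proof (rule continuous_on_compose2[OF that(3) continuous_on_subset[OF contr \<open>S \<subseteq> ?W\<close>]])
      show "r ` S \<subseteq> unit_square"
        using r \<open>S \<subseteq> ?W\<close> by blast
    qed
    show "m (r w) \<in> unit_square" if "w \<in> S" for w
      using that r \<open>S \<subseteq> ?W\<close> \<open>m ` unit_square \<subseteq> unit_square\<close> by blast
  qed simp
  let ?H = "\<lambda>w. if ?x w + ?y w \<le> 1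
      then (if ?x w \<le> ?y w then \<beta> (r w) else \<delta> (snd (r w), fst (r w)))
      else (if ?x w \<le> ?y w then \<alpha> (1 - snd (r w), 1 - fst (r w)) else \<gamma> (1 - fst (r w), 1 - snd (r w)))"
  have H: "continuous_map (top_of_set ?W) X ?H"
  proof (rule continuous_map_paste_le)
    show "continuous_map (top_of_set {w \<in> ?W. ?x w + ?y w \<le> 1}) X
        (\<lambda>w. if ?x w \<le> ?y w then \<beta> (r w) else \<delta> (snd (r w), fst (r w)))"
    proof (rule continuous_map_paste_le)
      show "\<beta> (r w) = \<delta> (snd (r w), fst (r w))"
        if "w \<in> {w \<in> ?W. ?x w + ?y w \<le> 1}" "?x w = ?y w" for w
        using that r[of w] rbottom[of w] by (intro ver_composable_sides[OF comp(4)]) auto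
      show "continuous_map (top_of_set {w \<in> {w \<in> ?W. ?x w + ?y w \<le> 1}. ?x w \<le> ?y w}) X (\<lambda>w. \<beta> (r w))"
        by (rule piece[OF sq(2), where m = "\<lambda>v. v"]) auto
      show "continuous_map (top_of_set {w \<in> {w \<in> ?W. ?x w + ?y w \<le> 1}. ?y w \<le> ?x w}) X
          (\<lambda>w. \<delta> (snd (r w), fst (r w)))"
        by (rule piece[OF sq(4), where m = "\<lambda>v. (snd v, fst v)"]) (auto intro!: continuous_intros)
    qed (intro continuous_intros)+
    show "continuous_map (top_of_set {w \<in> ?W. 1 \<le> ?x w + ?y w}) X
        (\<lambda>w. if ?x w \<le> ?y w then \<alpha> (1 - snd (r w), 1 - fst (r w)) else \<gamma> (1 - fst (r w), 1 - snd (r w)))"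
    proof (rule continuous_map_paste_le)
      show "\<alpha> (1 - snd (r w), 1 - fst (r w)) = \<gamma> (1 - fst (r w), 1 - snd (r w))"
        if "w \<in> {w \<in> ?W. 1 \<le> ?x w + ?y w}" "?x w = ?y w" for w
        \<comment> \<open>Reflection in the antidiagonal exchanges the conditions
          \<open>fst = 1\<close> and \<open>snd = 0\<close>, so the seam condition holds at the
          reflected point too.\<close>
        using that r[of w] rbottom[of w] ver_composable_sides[OF comp(3), of "(1 - snd (r w), 1 - fst (r w))"]
        by (cases "r w") auto
      show "continuous_map (top_of_set {w \<in> {w \<in> ?W. 1 \<le> ?x w + ?y w}. ?x w \<le> ?y w}) X
          (\<lambda>w. \<alpha> (1 - snd (r w), 1 - fst (r w)))"
        by (rule piece[OF sq(1), where m = "\<lambda>v. (1 - snd v, 1 - fst v)"]) (auto intro!: continuous_intros)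
      show "continuous_map (top_of_set {w \<in> {w \<in> ?W. 1 \<le> ?x w + ?y w}. ?y w \<le> ?x w}) X
          (\<lambda>w. \<gamma> (1 - fst (r w), 1 - snd (r w)))"
        by (rule piece[OF sq(3), where m = "\<lambda>v. (1 - fst v, 1 - snd v)"]) (auto intro!: continuous_intros)
    qed (intro continuous_intros)+
    show "(if ?x w \<le> ?y w then \<beta> (r w) else \<delta> (snd (r w), fst (r w)))
       = (if ?x w \<le> ?y w then \<alpha> (1 - snd (r w), 1 - fst (r w)) else \<gamma> (1 - fst (r w), 1 - snd (r w)))"
      if "w \<in> ?W" "?x w + ?y w = 1" for w
      using r[of w] rtop[of w] that hor_composable_sides[OF comp(1), of "r w"]
        hor_composable_sides[OF comp(2), of "(snd (r w), fst (r w))"]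
      by (cases "r w") auto
  qed (intro continuous_intros)+
  have Hquad: "?H (s, z) = quad \<alpha> \<beta> \<gamma> \<delta> (R s) z" if "z \<in> unit_square" for s z
    using that by (cases z) (simp add: quad_def r_def Let_def)
  have R01: "R 0 = T" "R 1 = T'"
    by (simp_all add: R_def fun_eq_iff)
  have "quad \<alpha> \<beta> \<gamma> \<delta> (R s) \<in> square_maps X" if "s \<in> {0..1}" for s
  proof -
    have "continuous_map (top_of_set unit_square) X (quad \<alpha> \<beta> \<gamma> \<delta> (R s))"
      by (rule continuous_map_reparam[OF H, where r = "\<lambda>z. (s, z)"])
        (use that in \<open>auto simp: Hquad[symmetric] simp del: fst_conv snd_conv intro!: continuous_intros\<close>)
    then show ?thesis
      by (simp add: square_maps_def quad_def)
  qed
  from this[of 0] this[of 1]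
  have "quad \<alpha> \<beta> \<gamma> \<delta> T \<in> square_maps X" "quad \<alpha> \<beta> \<gamma> \<delta> T' \<in> square_maps X"
    by (simp_all add: R01)
  then show ?thesis
  proof (rule homotopy_rel_boundaryI[where H = ?H])
    fix s :: real and z :: "real \<times> real" assume z: "z \<in> frontier unit_square"
    obtain x y where xy: "z = (x, y)"
      by fastforce
    have "\<bar>x + y - 1\<bar> + \<bar>y - x\<bar> = 1"
      using z by (auto simp: frontier_unit_square xy abs_if)
    from boundary[OF _ _ this] have "R s (\<bar>x + y - 1\<bar>, \<bar>y - x\<bar>) = T (\<bar>x + y - 1\<bar>, \<bar>y - x\<bar>)"
      by (simp add: R_def algebra_simps)
    then have "quad \<alpha> \<beta> \<gamma> \<delta> (R s) z = quad \<alpha> \<beta> \<gamma> \<delta> T z"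
      by (simp add: quad_def xy)
    then show "?H (s, z) = quad \<alpha> \<beta> \<gamma> \<delta> T z"
      using Hquad frontier_unit_square_subset[OF z] by metis
  next
    show "?H (0, z) = quad \<alpha> \<beta> \<gamma> \<delta> T z" "?H (1, z) = quad \<alpha> \<beta> \<gamma> \<delta> T' z"
      if "z \<in> unit_square" for z
      using Hquad[OF that] R01 by metis+
  qed (rule H)
qed

section \<open>Both composites as pastings of four triangles\<close>

lemma vcomp_map_lower:
  assumes "(x, y) \<in> unit_square" "y \<le> x"
  shows "vcomp_map f' f (x, y) = f (x - min y (1 - x), y + min y (1 - x))"
proof (cases "x + y = 1")
  case True
  then have "y = 1 - x"
    by simp
  then show ?thesis
    using assms by (auto simp: vcomp_map_def)
next
  case False
  then show ?thesis
    using assms by (auto simp: vcomp_map_def min_def add.commute add_diff_eq)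
qed

lemma vcomp_map_upper:
  assumes "ver_composable f' f" "(x, y) \<in> unit_square" "x \<le> y"
  shows "vcomp_map f' f (x, y) = f' (x + min x (1 - y), y - min x (1 - y))"
proof (cases "x = y")
  case True
  show ?thesis
  proof (cases "x + y \<le> 1")
    case le: True
    then show ?thesis
      using assms True ver_composableD(1)[OF assms(1), of "2 * x"] by (simp add: vcomp_map_lower min_def)
  next
    case False
    then show ?thesis
      using assms True ver_composableD(2)[OF assms(1), of "2 - 2 * x"] by (simp add: vcomp_map_lower min_def)
  qed
next
  case neq: False
  show ?thesis
  proof (cases "x + y = 1")
    case True
    then have "y = 1 - x"
      by simp
    then show ?thesis
      using assms neq by (auto simp: vcomp_map_def)
  next
    case False
    then show ?thesis
      using assms neq by (auto simp: vcomp_map_def min_def algebra_simps)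
  qed
qed

text \<open>On the left triangle p = 1 - x - y and q = y - x, hence 2x = 1 - p - q. Substituting
  this into the arguments of \<beta> in the two composites yields both reparametrisations; on the
  other triangles the symmetries of \<open>quad\<close> lead to the same formulas.\<close>

lemma interchange_eq_quad:
  assumes "hor_composable \<alpha> \<beta>" "hor_composable \<gamma> \<delta>" "ver_composable \<alpha> \<gamma>" "ver_composable \<beta> \<delta>"
  shows "vcomp_map (hcomp_map \<alpha> \<beta>) (hcomp_map \<gamma> \<delta>) =
      quad \<alpha> \<beta> \<gamma> \<delta> (\<lambda>(p, q). (min (2 * (1 - p - q)) (1 - p), min (1 - p) (2 * q)))" (is "?L = quad _ _ _ _ ?T")
    and "hcomp_map (vcomp_map \<alpha> \<gamma>) (vcomp_map \<beta> \<delta>) =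
      quad \<alpha> \<beta> \<gamma> \<delta> (\<lambda>(p, q). (min (2 * (1 - p - q)) (1 - q), max q (1 - 2 * p)))" (is "?L' = quad _ _ _ _ ?T'")
proof -
  have comp: "ver_composable (hcomp_map \<alpha> \<beta>) (hcomp_map \<gamma> \<delta>)" "hor_composable (vcomp_map \<alpha> \<gamma>) (vcomp_map \<beta> \<delta>)"
    using assms edges_hcomp_map[OF assms(1)] edges_hcomp_map[OF assms(2)]
      edges_vcomp_map[OF assms(3)] edges_vcomp_map[OF assms(4)]
    by (simp_all add: hor_composable_def ver_composable_def)
  have "?L (x, y) = quad \<alpha> \<beta> \<gamma> \<delta> ?T (x, y) \<and> ?L' (x, y) = quad \<alpha> \<beta> \<gamma> \<delta> ?T' (x, y)"
    if xy: "(x, y) \<in> unit_square" for x y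
  proof -
    consider "x + y \<le> 1" "x \<le> y" | "x + y \<le> 1" "\<not> x \<le> y" | "\<not> x + y \<le> 1" "x \<le> y" | "\<not> x + y \<le> 1" "\<not> x \<le> y"
      by blast
    then show ?thesis
    proof cases
      case 1
      have "?L (x, y) = \<beta> (2 * x + min (2 * x) (y - x), (y - x) + min (2 * x) (y - x))"
        using xy 1 by (simp add: vcomp_map_upper[OF comp(1)] hcomp_map_lower)
      moreover have "?L' (x, y) = \<beta> (2 * x + min (2 * x) (1 - (x + y)), (x + y) - min (2 * x) (1 - (x + y)))"
        using xy 1 by (simp add: hcomp_map_lower vcomp_map_upper[OF assms(4)] add.commute)
      moreover have "\<bar>x + y - 1\<bar> = 1 - x - y" "\<bar>y - x\<bar> = y - x"
        using 1 by linarith+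
      then have "quad \<alpha> \<beta> \<gamma> \<delta> T (x, y) = \<beta> (T (1 - x - y, y - x))" for T
        using xy 1 by (simp add: quad_def Let_def diff_diff_eq)
      ultimately show ?thesis
        by (auto intro!: arg_cong[where f = \<beta>] simp: min_def max_def)
    next
      case 2
      have "?L (x, y) = \<delta> ((x - y) + min (x - y) (2 * y), 2 * y + min (x - y) (2 * y))"
        using xy 2 by (simp add: vcomp_map_lower hcomp_map_lower)
      moreover have "?L' (x, y) = \<delta> ((x + y) - min (2 * y) (1 - (x + y)), 2 * y + min (2 * y) (1 - (x + y)))"
        using xy 2 by (simp add: hcomp_map_lower vcomp_map_lower)
      moreover have "\<bar>x + y - 1\<bar> = 1 - x - y" "\<bar>y - x\<bar> = x - y"
        using 2 by linarith+
      then have "quad \<alpha> \<beta> \<gamma> \<delta> T (x, y) = \<delta> (snd (T (1 - x - y, x - y)), fst (T (1 - x - y, x - y)))" for T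
        using xy 2 by (simp add: quad_def Let_def diff_diff_eq)
      ultimately show ?thesis
        by (auto intro!: arg_cong[where f = \<delta>] simp: min_def max_def)
    next
      case 3
      have "?L (x, y) = \<alpha> ((1 + x - y) + max (1 + x - y) (2 * y - 1) - 1, (2 * y - 1) + max (1 + x - y) (2 * y - 1) - 1)"
        using xy 3 by (simp add: vcomp_map_upper[OF comp(1)] hcomp_map_upper[OF assms(1)] min_def algebra_simps)
      moreover have "?L' (x, y) = \<alpha> ((x + y - 1) + min (x + y - 1) (2 - 2 * y), (2 * y - 1) - min (x + y - 1) (2 - 2 * y))"
        using xy 3 by (simp add: hcomp_map_upper[OF comp(2)] vcomp_map_upper[OF assms(3)] max_def)
      moreover have "\<bar>x + y - 1\<bar> = x + y - 1" "\<bar>y - x\<bar> = y - x"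
        using 3 by linarith+
      then have "quad \<alpha> \<beta> \<gamma> \<delta> T (x, y) = \<alpha> (1 - snd (T (x + y - 1, y - x)), 1 - fst (T (x + y - 1, y - x)))" for T
        using xy 3 by (simp add: quad_def Let_def diff_diff_eq)
      ultimately show ?thesis
        by (auto intro!: arg_cong[where f = \<alpha>] simp: min_def max_def)
    next
      case 4
      have "?L (x, y) = \<gamma> ((2 * x - 1) + max (2 * x - 1) (y + 1 - x) - 1, (y + 1 - x) + max (2 * x - 1) (y + 1 - x) - 1)"
        using xy 4 by (simp add: vcomp_map_lower hcomp_map_upper[OF assms(2)] min_def algebra_simps)
      moreover have "?L' (x, y) = \<gamma> ((2 * x - 1) - min (x + y - 1) (2 - 2 * x), (x + y - 1) + min (x + y - 1) (2 - 2 * x))"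
        using xy 4 by (simp add: hcomp_map_upper[OF comp(2)] vcomp_map_lower max_def algebra_simps)
      moreover have "\<bar>x + y - 1\<bar> = x + y - 1" "\<bar>y - x\<bar> = x - y"
        using 4 by linarith+
      then have "quad \<alpha> \<beta> \<gamma> \<delta> T (x, y) = \<gamma> (1 - fst (T (x + y - 1, x - y)), 1 - snd (T (x + y - 1, x - y)))" for T
        using xy 4 by (simp add: quad_def Let_def diff_diff_eq)
      ultimately show ?thesis
        by (auto intro!: arg_cong[where f = \<gamma>] simp: min_def max_def)
    qed
  qed
  moreover have "vcomp_map f g \<in> extensional unit_square" "quad \<alpha> \<beta> \<gamma> \<delta> T \<in> extensional unit_square" for f g T
    by (simp_all add: vcomp_map_def quad_def)
  ultimately show "?L = quad \<alpha> \<beta> \<gamma> \<delta> ?T" "?L' = quad \<alpha> \<beta> \<gamma> \<delta> ?T'"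
    by (auto intro!: extensionalityI[of _ unit_square] simp: hcomp_map_extensional)
qed

lemma interchange_maps:
  assumes sq: "\<alpha> \<in> square_maps X" "\<beta> \<in> square_maps X" "\<gamma> \<in> square_maps X" "\<delta> \<in> square_maps X"
    and comp: "hor_composable \<alpha> \<beta>" "hor_composable \<gamma> \<delta>" "ver_composable \<alpha> \<gamma>" "ver_composable \<beta> \<delta>"
  shows "(vcomp_map (hcomp_map \<alpha> \<beta>) (hcomp_map \<gamma> \<delta>), hcomp_map (vcomp_map \<alpha> \<gamma>) (vcomp_map \<beta> \<delta>))
           \<in> homotopy_rel_boundary X"
proof -
  \<comment> \<open>The straight line from \<open>?T1\<close> to \<open>?T4\<close> violates the boundary conditions, as the union of two
    edges is not convex; \<open>?T2\<close> and \<open>?T3\<close> reach the right edge for both \<open>p\<close> and \<open>q\<close> at \<open>1 / 2\<close>.\<close>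
  let ?T1 = "\<lambda>(p, q). (min (2 * (1 - p - q)) (1 - p), min (1 - p) (2 * q)) :: real \<times> real"
  let ?T2 = "\<lambda>(p, q). (min 1 (2 * (1 - p - q)), min (1 - p) (2 * q)) :: real \<times> real"
  let ?T3 = "\<lambda>(p, q). (min 1 (2 * (1 - p - q)), max q (1 - 2 * p)) :: real \<times> real"
  let ?T4 = "\<lambda>(p, q). (min (2 * (1 - p - q)) (1 - q), max q (1 - 2 * p)) :: real \<times> real"
  note homotopic = quad_homotopic[OF sq comp]
  have cont: "continuous_on diagonal_distances ?T1" "continuous_on diagonal_distances ?T2"
    "continuous_on diagonal_distances ?T3" "continuous_on diagonal_distances ?T4"
    unfolding case_prod_unfold by (intro continuous_intros)+
  have im: "?T1 ` diagonal_distances \<subseteq> unit_square" "?T2 ` diagonal_distances \<subseteq> unit_square"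
    "?T3 ` diagonal_distances \<subseteq> unit_square" "?T4 ` diagonal_distances \<subseteq> unit_square"
    by (auto simp: min_def max_def)
  \<comment> \<open>On the side \<open>q = 0\<close> the image slides along the bottom edge until it
    rests at the corner (1, 0) for \<open>p \<le> 1 / 2\<close>; the side \<open>p = 0\<close> does
    not move.\<close>
  have "(quad \<alpha> \<beta> \<gamma> \<delta> ?T1, quad \<alpha> \<beta> \<gamma> \<delta> ?T2) \<in> homotopy_rel_boundary X"
    by (rule homotopic[OF cont(1) im(1) cont(2) im(2)]) (auto simp: min_def)
  \<comment> \<open>This step transfers the shared edge. At time s the centre is at (1, s) on the
    right edge: the part above this point still lies along the antidiagonal, the part below already
    along the diagonal.\<close>
  moreover have "(quad \<alpha> \<beta> \<gamma> \<delta> ?T2, quad \<alpha> \<beta> \<gamma> \<delta> ?T3) \<in> homotopy_rel_boundary X"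
    by (rule homotopic[OF cont(2) im(2) cont(3) im(3)]) (auto simp: min_def max_def)
  \<comment> \<open>Counterpart of the first step: the side \<open>p = 0\<close> leaves the corner
    (1, 1) along the top edge, and \<open>q = 0\<close> does not move.\<close>
  moreover have "(quad \<alpha> \<beta> \<gamma> \<delta> ?T3, quad \<alpha> \<beta> \<gamma> \<delta> ?T4) \<in> homotopy_rel_boundary X"
    by (rule homotopic[OF cont(3) im(3) cont(4) im(4)]) (auto simp: min_def max_def)
  moreover have "trans (homotopy_rel_boundary X)"
    using equiv_homotopy_rel_boundary by (rule equivE)
  ultimately show ?thesis
    unfolding interchange_eq_quad[OF comp] by (meson transE)
qed

section \<open>The double groupoid of homotopy classes\<close>

lemma square_class_eqI: "(f, g) \<in> homotopy_rel_boundary X \<Longrightarrow> square_class X f = square_class X g"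
  unfolding square_class_def by (rule equiv_class_eq[OF equiv_homotopy_rel_boundary])

lemma square_class_self: "f \<in> square_maps X \<Longrightarrow> f \<in> square_class X f"
  unfolding square_class_def by (rule equiv_class_self[OF equiv_homotopy_rel_boundary])

lemma mem_square_class: "g \<in> square_class X f \<longleftrightarrow> (f, g) \<in> homotopy_rel_boundary X"
  by (simp add: square_class_def)

lemma the_elem_square_class:
  assumes "f \<in> square_maps X" "\<And>g. (f, g) \<in> homotopy_rel_boundary X \<Longrightarrow> E g = E f"
  shows "the_elem (E ` square_class X f) = E f"
proof (rule the_elem_image_unique)
  show "square_class X f \<noteq> {}"
    using square_class_self[OF assms(1)] by blast
  show "E g = E f" if "g \<in> square_class X f" for g
    using that by (intro assms(2)) (simp add: mem_square_class)
qed

text \<open>All classes in the union coincide, and the index sets are nonempty because a class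
  contains its representative.\<close>

lemma UN_square_class:
  assumes "f' \<in> square_maps X" "f \<in> square_maps X"
    and "\<And>g' g. \<lbrakk>(f', g') \<in> homotopy_rel_boundary X; (f, g) \<in> homotopy_rel_boundary X\<rbrakk>
      \<Longrightarrow> (c f' f, c g' g) \<in> homotopy_rel_boundary X"
  shows "(\<Union>\<alpha>'\<in>square_class X f'. \<Union>\<alpha>\<in>square_class X f. square_class X (c \<alpha>' \<alpha>)) = square_class X (c f' f)"
proof -
  have "square_class X (c \<alpha>' \<alpha>) = square_class X (c f' f)"
    if "\<alpha>' \<in> square_class X f'" "\<alpha> \<in> square_class X f" for \<alpha>' \<alpha>
    using that assms(3) square_class_eqI by (metis mem_square_class)
  then have "(\<Union>\<alpha>'\<in>square_class X f'. \<Union>\<alpha>\<in>square_class X f. square_class X (c \<alpha>' \<alpha>))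
      = (\<Union>\<alpha>'\<in>square_class X f'. \<Union>\<alpha>\<in>square_class X f. square_class X (c f' f))"
    by (intro SUP_cong refl)
  then show ?thesis
    using square_class_self[OF assms(1)] square_class_self[OF assms(2)] by (auto split: if_splits)
qed

abbreviation \<Pi>\<^sub>2 :: "'a topology \<Rightarrow>
    (real \<Rightarrow> 'a, 'a morphism, 'a morphism, (real \<times> real \<Rightarrow> 'a) set) double_structure" where
  "\<Pi>\<^sub>2 \<equiv> homotopy_double_groupoid"

lemma morphisms_simps:
  "Obj (\<Pi>\<^sub>2 X) = paths X"
  "Hor (\<Pi>\<^sub>2 X) = {(u, u'). u \<in> paths X \<and> u' \<in> paths X \<and> u 1 = u' 1}"
  "Ver (\<Pi>\<^sub>2 X) = {(u, v). u \<in> paths X \<and> v \<in> paths X \<and> u 0 = v 0}"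
  "hsrc (\<Pi>\<^sub>2 X) = fst" "htgt (\<Pi>\<^sub>2 X) = snd" "hidt (\<Pi>\<^sub>2 X) u = (u, u)"
  "hcomp (\<Pi>\<^sub>2 X) m n = (fst n, snd m)"
  "vsrc (\<Pi>\<^sub>2 X) = fst" "vtgt (\<Pi>\<^sub>2 X) = snd" "vidt (\<Pi>\<^sub>2 X) u = (u, u)"
  "vcomp (\<Pi>\<^sub>2 X) m n = (fst n, snd m)"
  "Hidt (\<Pi>\<^sub>2 X) (u, v) = square_class X (hid_map u v)"
  "Vidt (\<Pi>\<^sub>2 X) (u, v) = square_class X (vid_map u v)"
  by (simp_all add: homotopy_double_groupoid_def)

lemma square_class_in_Sqr: "f \<in> square_maps X \<Longrightarrow> square_class X f \<in> Sqr (\<Pi>\<^sub>2 X)"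
  by (simp add: homotopy_double_groupoid_def square_class_def quotientI)

lemma SqrE:
  assumes "a \<in> Sqr (\<Pi>\<^sub>2 X)"
  obtains f where "f \<in> square_maps X" "a = square_class X f"
  using assms by (auto simp: homotopy_double_groupoid_def square_class_def elim: quotientE)

lemma square_class_boundary:
  assumes "f \<in> square_maps X"
  shows "Hsrc (\<Pi>\<^sub>2 X) (square_class X f) = (edge_u f, edge_v f)"
    "Htgt (\<Pi>\<^sub>2 X) (square_class X f) = (edge_u' f, edge_v' f)"
    "Vsrc (\<Pi>\<^sub>2 X) (square_class X f) = (edge_u f, edge_u' f)"
    "Vtgt (\<Pi>\<^sub>2 X) (square_class X f) = (edge_v f, edge_v' f)"
proof -
  have "edge_u g = edge_u f" "edge_v g = edge_v f" "edge_u' g = edge_u' f" "edge_v' g = edge_v' f"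
    if "(f, g) \<in> homotopy_rel_boundary X" for g
    by (rule edges_cong; rule homotopy_rel_boundary_frontier[OF that]; assumption)+
  then have "the_elem ((\<lambda>\<alpha>. (edge_u \<alpha>, edge_v \<alpha>)) ` square_class X f) = (edge_u f, edge_v f)"
    "the_elem ((\<lambda>\<alpha>. (edge_u' \<alpha>, edge_v' \<alpha>)) ` square_class X f) = (edge_u' f, edge_v' f)"
    "the_elem ((\<lambda>\<alpha>. (edge_u \<alpha>, edge_u' \<alpha>)) ` square_class X f) = (edge_u f, edge_u' f)"
    "the_elem ((\<lambda>\<alpha>. (edge_v \<alpha>, edge_v' \<alpha>)) ` square_class X f) = (edge_v f, edge_v' f)"
    by - (rule the_elem_square_class[OF assms]; blast)+
  then show "Hsrc (\<Pi>\<^sub>2 X) (square_class X f) = (edge_u f, edge_v f)"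
    "Htgt (\<Pi>\<^sub>2 X) (square_class X f) = (edge_u' f, edge_v' f)"
    "Vsrc (\<Pi>\<^sub>2 X) (square_class X f) = (edge_u f, edge_u' f)"
    "Vtgt (\<Pi>\<^sub>2 X) (square_class X f) = (edge_v f, edge_v' f)"
    by (simp_all add: homotopy_double_groupoid_def)
qed

lemma composable_iff:
  assumes "f' \<in> square_maps X" "f \<in> square_maps X"
  shows "Hsrc (\<Pi>\<^sub>2 X) (square_class X f') = Htgt (\<Pi>\<^sub>2 X) (square_class X f) \<longleftrightarrow> hor_composable f' f"
    "Vsrc (\<Pi>\<^sub>2 X) (square_class X f') = Vtgt (\<Pi>\<^sub>2 X) (square_class X f) \<longleftrightarrow> ver_composable f' f"
  using assms by (simp_all add: square_class_boundary hor_composable_def ver_composable_def)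

lemma Hcomp_square_class:
  assumes "f' \<in> square_maps X" "f \<in> square_maps X" "hor_composable f' f"
  shows "Hcomp (\<Pi>\<^sub>2 X) (square_class X f') (square_class X f) = square_class X (hcomp_map f' f)"
  unfolding homotopy_double_groupoid_def double_structure.simps
  using assms by (intro UN_square_class hcomp_map_homotopic)

lemma Vcomp_square_class:
  assumes "f' \<in> square_maps X" "f \<in> square_maps X" "ver_composable f' f"
  shows "Vcomp (\<Pi>\<^sub>2 X) (square_class X f') (square_class X f) = square_class X (vcomp_map f' f)"
  unfolding homotopy_double_groupoid_def double_structure.simps
  using assms by (intro UN_square_class vcomp_map_homotopic)

section \<open>The four constituent groupoids\<close>

lemma groupoid_hor:
  "groupoid (Hor (\<Pi>\<^sub>2 X)) (Obj (\<Pi>\<^sub>2 X)) (hsrc (\<Pi>\<^sub>2 X)) (htgt (\<Pi>\<^sub>2 X)) (hidt (\<Pi>\<^sub>2 X)) (hcomp (\<Pi>\<^sub>2 X))"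
  by unfold_locales (auto simp: morphisms_simps)

lemma groupoid_ver:
  "groupoid (Ver (\<Pi>\<^sub>2 X)) (Obj (\<Pi>\<^sub>2 X)) (vsrc (\<Pi>\<^sub>2 X)) (vtgt (\<Pi>\<^sub>2 X)) (vidt (\<Pi>\<^sub>2 X)) (vcomp (\<Pi>\<^sub>2 X))"
  by unfold_locales (auto simp: morphisms_simps)

lemma groupoid_Hor:
  "groupoid (Sqr (\<Pi>\<^sub>2 X)) (Ver (\<Pi>\<^sub>2 X)) (Hsrc (\<Pi>\<^sub>2 X)) (Htgt (\<Pi>\<^sub>2 X)) (Hidt (\<Pi>\<^sub>2 X)) (Hcomp (\<Pi>\<^sub>2 X))"
proof unfold_locales
  fix a assume "a \<in> Sqr (\<Pi>\<^sub>2 X)"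
  then obtain f where f: "f \<in> square_maps X" and a: "a = square_class X f"
    by (rule SqrE)
  note boundary = square_class_boundary[OF f, folded a]
  show "Hsrc (\<Pi>\<^sub>2 X) a \<in> Ver (\<Pi>\<^sub>2 X)" "Htgt (\<Pi>\<^sub>2 X) a \<in> Ver (\<Pi>\<^sub>2 X)"
    using edges_in_paths[OF f] edges_endpoints(1,2)[of f] by (auto simp: boundary morphisms_simps)
  have id: "hid_map (edge_u f) (edge_v f) \<in> square_maps X" "hid_map (edge_u' f) (edge_v' f) \<in> square_maps X"
    using edges_in_paths[OF f] edges_endpoints(1,2)[of f] by (auto intro: hid_map_square_maps)
  show "Hcomp (\<Pi>\<^sub>2 X) a (Hidt (\<Pi>\<^sub>2 X) (Hsrc (\<Pi>\<^sub>2 X) a)) = a"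
    unfolding boundary morphisms_simps unfolding a Hcomp_square_class[OF f id(1) hor_composable_hid_map(1)[OF f]]
    by (rule square_class_eqI[OF hcomp_map_hid_right[OF f]])
  show "Hcomp (\<Pi>\<^sub>2 X) (Hidt (\<Pi>\<^sub>2 X) (Htgt (\<Pi>\<^sub>2 X) a)) a = a"
    unfolding boundary morphisms_simps unfolding a Hcomp_square_class[OF id(2) f hor_composable_hid_map(2)[OF f]]
    by (rule square_class_eqI[OF hcomp_map_hid_left[OF f]])
  show "\<exists>b\<in>Sqr (\<Pi>\<^sub>2 X). Hsrc (\<Pi>\<^sub>2 X) b = Htgt (\<Pi>\<^sub>2 X) a \<and> Htgt (\<Pi>\<^sub>2 X) b = Hsrc (\<Pi>\<^sub>2 X) a \<and>
      Hcomp (\<Pi>\<^sub>2 X) b a = Hidt (\<Pi>\<^sub>2 X) (Hsrc (\<Pi>\<^sub>2 X) a) \<and> Hcomp (\<Pi>\<^sub>2 X) a b = Hidt (\<Pi>\<^sub>2 X) (Htgt (\<Pi>\<^sub>2 X) a)"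
  proof (intro bexI conjI)
    let ?b = "square_class X (hinv_map f)"
    note g = hinv_map_square_maps[OF f]
    show "Hsrc (\<Pi>\<^sub>2 X) ?b = Htgt (\<Pi>\<^sub>2 X) a" "Htgt (\<Pi>\<^sub>2 X) ?b = Hsrc (\<Pi>\<^sub>2 X) a"
      by (simp_all add: boundary square_class_boundary[OF g] edges_hinv_map)
    show "Hcomp (\<Pi>\<^sub>2 X) ?b a = Hidt (\<Pi>\<^sub>2 X) (Hsrc (\<Pi>\<^sub>2 X) a)"
      unfolding boundary morphisms_simps unfolding a Hcomp_square_class[OF g f hor_composable_hinv_map(1)]
      by (rule square_class_eqI[OF hcomp_map_hinv_left[OF f]])
    show "Hcomp (\<Pi>\<^sub>2 X) a ?b = Hidt (\<Pi>\<^sub>2 X) (Htgt (\<Pi>\<^sub>2 X) a)"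
      unfolding boundary morphisms_simps unfolding a Hcomp_square_class[OF f g hor_composable_hinv_map(2)]
      by (rule square_class_eqI[OF hcomp_map_hinv_right[OF f]])
    show "?b \<in> Sqr (\<Pi>\<^sub>2 X)"
      by (rule square_class_in_Sqr[OF g])
  qed
next
  fix m assume "m \<in> Ver (\<Pi>\<^sub>2 X)"
  then obtain u v where m: "m = (u, v)" and uv: "u \<in> paths X" "v \<in> paths X" "u 0 = v 0"
    by (auto simp: morphisms_simps)
  note sq = hid_map_square_maps[OF uv]
  show "Hidt (\<Pi>\<^sub>2 X) m \<in> Sqr (\<Pi>\<^sub>2 X)" "Hsrc (\<Pi>\<^sub>2 X) (Hidt (\<Pi>\<^sub>2 X) m) = m" "Htgt (\<Pi>\<^sub>2 X) (Hidt (\<Pi>\<^sub>2 X) m) = m"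
    unfolding m morphisms_simps
    by (simp_all add: square_class_in_Sqr sq square_class_boundary[OF sq] edges_hid_map[OF uv])
next
  fix a b assume "a \<in> Sqr (\<Pi>\<^sub>2 X)" "b \<in> Sqr (\<Pi>\<^sub>2 X)" and ab: "Hsrc (\<Pi>\<^sub>2 X) a = Htgt (\<Pi>\<^sub>2 X) b"
  then obtain f g where f: "f \<in> square_maps X" "a = square_class X f" and g: "g \<in> square_maps X" "b = square_class X g"
    by (meson SqrE)
  have fg: "hor_composable f g"
    using ab f g by (simp add: composable_iff)
  note sq = hcomp_map_square_maps[OF f(1) g(1) fg]
  have eq: "Hcomp (\<Pi>\<^sub>2 X) a b = square_class X (hcomp_map f g)"
    using f g fg by (simp add: Hcomp_square_class)
  show "Hcomp (\<Pi>\<^sub>2 X) a b \<in> Sqr (\<Pi>\<^sub>2 X)" "Hsrc (\<Pi>\<^sub>2 X) (Hcomp (\<Pi>\<^sub>2 X) a b) = Hsrc (\<Pi>\<^sub>2 X) b"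
    "Htgt (\<Pi>\<^sub>2 X) (Hcomp (\<Pi>\<^sub>2 X) a b) = Htgt (\<Pi>\<^sub>2 X) a"
    unfolding eq unfolding f(2) g(2)
    by (simp_all add: sq square_class_in_Sqr square_class_boundary f(1) g(1) edges_hcomp_map[OF fg])
  fix c assume "c \<in> Sqr (\<Pi>\<^sub>2 X)" and bc: "Hsrc (\<Pi>\<^sub>2 X) b = Htgt (\<Pi>\<^sub>2 X) c"
  then obtain h where h: "h \<in> square_maps X" "c = square_class X h"
    by (meson SqrE)
  have gh: "hor_composable g h"
    using bc g h by (simp add: composable_iff)
  have "hor_composable (hcomp_map f g) h" "hor_composable f (hcomp_map g h)"
    using fg gh edges_hcomp_map[OF fg] edges_hcomp_map[OF gh] by (simp_all add: hor_composable_def)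
  then show "Hcomp (\<Pi>\<^sub>2 X) (Hcomp (\<Pi>\<^sub>2 X) a b) c = Hcomp (\<Pi>\<^sub>2 X) a (Hcomp (\<Pi>\<^sub>2 X) b c)"
    using f g h fg gh square_class_eqI[OF hcomp_map_assoc[OF f(1) g(1) h(1) fg gh]]
    by (simp add: Hcomp_square_class hcomp_map_square_maps)
qed

lemma groupoid_Ver:
  "groupoid (Sqr (\<Pi>\<^sub>2 X)) (Hor (\<Pi>\<^sub>2 X)) (Vsrc (\<Pi>\<^sub>2 X)) (Vtgt (\<Pi>\<^sub>2 X)) (Vidt (\<Pi>\<^sub>2 X)) (Vcomp (\<Pi>\<^sub>2 X))"
proof unfold_locales
  fix a assume "a \<in> Sqr (\<Pi>\<^sub>2 X)"
  then obtain f where f: "f \<in> square_maps X" and a: "a = square_class X f"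
    by (rule SqrE)
  note boundary = square_class_boundary[OF f, folded a]
  show "Vsrc (\<Pi>\<^sub>2 X) a \<in> Hor (\<Pi>\<^sub>2 X)" "Vtgt (\<Pi>\<^sub>2 X) a \<in> Hor (\<Pi>\<^sub>2 X)"
    using edges_in_paths[OF f] edges_endpoints(3,4)[of f] by (auto simp: boundary morphisms_simps)
  note id_u = vid_map_square_maps[OF edges_in_paths(1)[OF f] edges_in_paths(3)[OF f] edges_endpoints(3)]
  note id_v = vid_map_square_maps[OF edges_in_paths(2)[OF f] edges_in_paths(4)[OF f] edges_endpoints(4)]
  note edges_id_u = edges_vid_map[OF edges_in_paths(1)[OF f] edges_in_paths(3)[OF f] edges_endpoints(3)]
  note edges_id_v = edges_vid_map[OF edges_in_paths(2)[OF f] edges_in_paths(4)[OF f] edges_endpoints(4)]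
  have comp: "ver_composable f (vid_map (edge_u f) (edge_u' f))" "ver_composable (vid_map (edge_v f) (edge_v' f)) f"
    by (simp_all add: ver_composable_def edges_id_u edges_id_v)
  show "Vcomp (\<Pi>\<^sub>2 X) a (Vidt (\<Pi>\<^sub>2 X) (Vsrc (\<Pi>\<^sub>2 X) a)) = a"
    unfolding boundary morphisms_simps unfolding a Vcomp_square_class[OF f id_u comp(1)]
    by (rule square_class_eqI[OF vertical_groupoid_laws(1)[OF f]])
  show "Vcomp (\<Pi>\<^sub>2 X) (Vidt (\<Pi>\<^sub>2 X) (Vtgt (\<Pi>\<^sub>2 X) a)) a = a"
    unfolding boundary morphisms_simps unfolding a Vcomp_square_class[OF id_v f comp(2)]
    by (rule square_class_eqI[OF vertical_groupoid_laws(2)[OF f]])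
  show "\<exists>b\<in>Sqr (\<Pi>\<^sub>2 X). Vsrc (\<Pi>\<^sub>2 X) b = Vtgt (\<Pi>\<^sub>2 X) a \<and> Vtgt (\<Pi>\<^sub>2 X) b = Vsrc (\<Pi>\<^sub>2 X) a \<and>
      Vcomp (\<Pi>\<^sub>2 X) b a = Vidt (\<Pi>\<^sub>2 X) (Vsrc (\<Pi>\<^sub>2 X) a) \<and> Vcomp (\<Pi>\<^sub>2 X) a b = Vidt (\<Pi>\<^sub>2 X) (Vtgt (\<Pi>\<^sub>2 X) a)"
  proof (intro bexI conjI)
    let ?b = "square_class X (vinv_map f)"
    note g = vinv_map_square_maps[OF f]
    have comp: "ver_composable (vinv_map f) f" "ver_composable f (vinv_map f)"
      by (simp_all add: ver_composable_def edges_vinv_map)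
    show "Vsrc (\<Pi>\<^sub>2 X) ?b = Vtgt (\<Pi>\<^sub>2 X) a" "Vtgt (\<Pi>\<^sub>2 X) ?b = Vsrc (\<Pi>\<^sub>2 X) a"
      by (simp_all add: boundary square_class_boundary[OF g] edges_vinv_map)
    show "Vcomp (\<Pi>\<^sub>2 X) ?b a = Vidt (\<Pi>\<^sub>2 X) (Vsrc (\<Pi>\<^sub>2 X) a)"
      unfolding boundary morphisms_simps unfolding a Vcomp_square_class[OF g f comp(1)]
      by (rule square_class_eqI[OF vertical_groupoid_laws(3)[OF f]])
    show "Vcomp (\<Pi>\<^sub>2 X) a ?b = Vidt (\<Pi>\<^sub>2 X) (Vtgt (\<Pi>\<^sub>2 X) a)"
      unfolding boundary morphisms_simps unfolding a Vcomp_square_class[OF f g comp(2)]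
      by (rule square_class_eqI[OF vertical_groupoid_laws(4)[OF f]])
    show "?b \<in> Sqr (\<Pi>\<^sub>2 X)"
      by (rule square_class_in_Sqr[OF g])
  qed
next
  fix m assume "m \<in> Hor (\<Pi>\<^sub>2 X)"
  then obtain u v where m: "m = (u, v)" and uv: "u \<in> paths X" "v \<in> paths X" "u 1 = v 1"
    by (auto simp: morphisms_simps)
  note sq = vid_map_square_maps[OF uv]
  show "Vidt (\<Pi>\<^sub>2 X) m \<in> Sqr (\<Pi>\<^sub>2 X)" "Vsrc (\<Pi>\<^sub>2 X) (Vidt (\<Pi>\<^sub>2 X) m) = m" "Vtgt (\<Pi>\<^sub>2 X) (Vidt (\<Pi>\<^sub>2 X) m) = m"
    unfolding m morphisms_simps
    by (simp_all add: square_class_in_Sqr sq square_class_boundary[OF sq] edges_vid_map[OF uv])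
next
  fix a b assume "a \<in> Sqr (\<Pi>\<^sub>2 X)" "b \<in> Sqr (\<Pi>\<^sub>2 X)" and ab: "Vsrc (\<Pi>\<^sub>2 X) a = Vtgt (\<Pi>\<^sub>2 X) b"
  then obtain f g where f: "f \<in> square_maps X" "a = square_class X f" and g: "g \<in> square_maps X" "b = square_class X g"
    by (meson SqrE)
  have fg: "ver_composable f g"
    using ab f g by (simp add: composable_iff)
  note sq = vcomp_map_square_maps[OF f(1) g(1) fg]
  have eq: "Vcomp (\<Pi>\<^sub>2 X) a b = square_class X (vcomp_map f g)"
    using f g fg by (simp add: Vcomp_square_class)
  show "Vcomp (\<Pi>\<^sub>2 X) a b \<in> Sqr (\<Pi>\<^sub>2 X)" "Vsrc (\<Pi>\<^sub>2 X) (Vcomp (\<Pi>\<^sub>2 X) a b) = Vsrc (\<Pi>\<^sub>2 X) b"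
    "Vtgt (\<Pi>\<^sub>2 X) (Vcomp (\<Pi>\<^sub>2 X) a b) = Vtgt (\<Pi>\<^sub>2 X) a"
    unfolding eq unfolding f(2) g(2)
    by (simp_all add: sq square_class_in_Sqr square_class_boundary f(1) g(1) edges_vcomp_map[OF fg])
  fix c assume "c \<in> Sqr (\<Pi>\<^sub>2 X)" and bc: "Vsrc (\<Pi>\<^sub>2 X) b = Vtgt (\<Pi>\<^sub>2 X) c"
  then obtain h where h: "h \<in> square_maps X" "c = square_class X h"
    by (meson SqrE)
  have gh: "ver_composable g h"
    using bc g h by (simp add: composable_iff)
  have "ver_composable (vcomp_map f g) h" "ver_composable f (vcomp_map g h)"
    using fg gh edges_vcomp_map[OF fg] edges_vcomp_map[OF gh] by (simp_all add: ver_composable_def)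
  then show "Vcomp (\<Pi>\<^sub>2 X) (Vcomp (\<Pi>\<^sub>2 X) a b) c = Vcomp (\<Pi>\<^sub>2 X) a (Vcomp (\<Pi>\<^sub>2 X) b c)"
    using f g h fg gh square_class_eqI[OF vcomp_map_assoc[OF f(1) g(1) h(1) fg gh]]
    by (simp add: Vcomp_square_class vcomp_map_square_maps)
qed

lemma interchange_classes:
  assumes sq: "a \<in> Sqr (\<Pi>\<^sub>2 X)" "b \<in> Sqr (\<Pi>\<^sub>2 X)" "c \<in> Sqr (\<Pi>\<^sub>2 X)" "d \<in> Sqr (\<Pi>\<^sub>2 X)"
    and comp: "Hsrc (\<Pi>\<^sub>2 X) a = Htgt (\<Pi>\<^sub>2 X) b" "Hsrc (\<Pi>\<^sub>2 X) c = Htgt (\<Pi>\<^sub>2 X) d"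
      "Vsrc (\<Pi>\<^sub>2 X) a = Vtgt (\<Pi>\<^sub>2 X) c" "Vsrc (\<Pi>\<^sub>2 X) b = Vtgt (\<Pi>\<^sub>2 X) d"
  shows "Vcomp (\<Pi>\<^sub>2 X) (Hcomp (\<Pi>\<^sub>2 X) a b) (Hcomp (\<Pi>\<^sub>2 X) c d)
       = Hcomp (\<Pi>\<^sub>2 X) (Vcomp (\<Pi>\<^sub>2 X) a c) (Vcomp (\<Pi>\<^sub>2 X) b d)"
proof -
  obtain \<alpha> \<beta> \<gamma> \<delta> where abcd: "a = square_class X \<alpha>" "b = square_class X \<beta>" "c = square_class X \<gamma>" "d = square_class X \<delta>"
    and maps: "\<alpha> \<in> square_maps X" "\<beta> \<in> square_maps X" "\<gamma> \<in> square_maps X" "\<delta> \<in> square_maps X"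
    using sq by (meson SqrE)
  have compm: "hor_composable \<alpha> \<beta>" "hor_composable \<gamma> \<delta>" "ver_composable \<alpha> \<gamma>" "ver_composable \<beta> \<delta>"
    using comp maps by (simp_all add: abcd composable_iff)
  then have "ver_composable (hcomp_map \<alpha> \<beta>) (hcomp_map \<gamma> \<delta>)" "hor_composable (vcomp_map \<alpha> \<gamma>) (vcomp_map \<beta> \<delta>)"
    using edges_hcomp_map[OF compm(1)] edges_hcomp_map[OF compm(2)]
      edges_vcomp_map[OF compm(3)] edges_vcomp_map[OF compm(4)]
    by (simp_all add: hor_composable_def ver_composable_def)
  then show ?thesis
    using maps compm square_class_eqI[OF interchange_maps[OF maps compm]]
    by (simp add: abcd Hcomp_square_class Vcomp_square_class hcomp_map_square_maps vcomp_map_square_maps)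
qed

lemma (in groupoid) idempotent_eq_idt:
  assumes f: "f \<in> Arr" "src f = tgt f" "f \<cdot> f = f"
  shows "f = idt (src f)"
proof -
  obtain g where g: "g \<in> Arr" "src g = tgt f" "g \<cdot> f = idt (src f)"
    using inverse_ex[OF f(1)] by blast
  have "f = (g \<cdot> f) \<cdot> f"
    using comp_idt_left[OF f(1)] f(2) g(3) by simp
  also have "\<dots> = g \<cdot> f"
    using comp_assoc[OF g(1) f(1) f(1) g(2) f(2)] f(3) by simp
  finally show ?thesis
    by (simp add: g(3))
qed

text \<open>
  The remaining axioms on identity squares hold because the square in question is idempotent, by
  interchange, in a groupoid.
\<close>

lemma double_groupoid_homotopy_classes: "double_groupoid (\<Pi>\<^sub>2 X)"
proof -
  interpret hor: groupoid "Hor (\<Pi>\<^sub>2 X)" "Obj (\<Pi>\<^sub>2 X)" "hsrc (\<Pi>\<^sub>2 X)" "htgt (\<Pi>\<^sub>2 X)" "hidt (\<Pi>\<^sub>2 X)" "hcomp (\<Pi>\<^sub>2 X)"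
    by (rule groupoid_hor)
  interpret ver: groupoid "Ver (\<Pi>\<^sub>2 X)" "Obj (\<Pi>\<^sub>2 X)" "vsrc (\<Pi>\<^sub>2 X)" "vtgt (\<Pi>\<^sub>2 X)" "vidt (\<Pi>\<^sub>2 X)" "vcomp (\<Pi>\<^sub>2 X)"
    by (rule groupoid_ver)
  interpret Hor: groupoid "Sqr (\<Pi>\<^sub>2 X)" "Ver (\<Pi>\<^sub>2 X)" "Hsrc (\<Pi>\<^sub>2 X)" "Htgt (\<Pi>\<^sub>2 X)" "Hidt (\<Pi>\<^sub>2 X)" "Hcomp (\<Pi>\<^sub>2 X)"
    by (rule groupoid_Hor)
  interpret Ver: groupoid "Sqr (\<Pi>\<^sub>2 X)" "Hor (\<Pi>\<^sub>2 X)" "Vsrc (\<Pi>\<^sub>2 X)" "Vtgt (\<Pi>\<^sub>2 X)" "Vidt (\<Pi>\<^sub>2 X)" "Vcomp (\<Pi>\<^sub>2 X)"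
    by (rule groupoid_Ver)
  have Hidt_boundary: "Vsrc (\<Pi>\<^sub>2 X) (Hidt (\<Pi>\<^sub>2 X) m) = hidt (\<Pi>\<^sub>2 X) (vsrc (\<Pi>\<^sub>2 X) m)"
    "Vtgt (\<Pi>\<^sub>2 X) (Hidt (\<Pi>\<^sub>2 X) m) = hidt (\<Pi>\<^sub>2 X) (vtgt (\<Pi>\<^sub>2 X) m)" if "m \<in> Ver (\<Pi>\<^sub>2 X)" for m
    using that by (auto simp: morphisms_simps square_class_boundary hid_map_square_maps edges_hid_map)
  have Vidt_boundary: "Hsrc (\<Pi>\<^sub>2 X) (Vidt (\<Pi>\<^sub>2 X) m) = vidt (\<Pi>\<^sub>2 X) (hsrc (\<Pi>\<^sub>2 X) m)"
    "Htgt (\<Pi>\<^sub>2 X) (Vidt (\<Pi>\<^sub>2 X) m) = vidt (\<Pi>\<^sub>2 X) (htgt (\<Pi>\<^sub>2 X) m)" if "m \<in> Hor (\<Pi>\<^sub>2 X)" for m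
    using that by (auto simp: morphisms_simps square_class_boundary vid_map_square_maps edges_vid_map)
  have Hcomp_boundary: "Vsrc (\<Pi>\<^sub>2 X) (Hcomp (\<Pi>\<^sub>2 X) a b) = hcomp (\<Pi>\<^sub>2 X) (Vsrc (\<Pi>\<^sub>2 X) a) (Vsrc (\<Pi>\<^sub>2 X) b)"
    "Vtgt (\<Pi>\<^sub>2 X) (Hcomp (\<Pi>\<^sub>2 X) a b) = hcomp (\<Pi>\<^sub>2 X) (Vtgt (\<Pi>\<^sub>2 X) a) (Vtgt (\<Pi>\<^sub>2 X) b)"
    if ab: "a \<in> Sqr (\<Pi>\<^sub>2 X)" "b \<in> Sqr (\<Pi>\<^sub>2 X)" "Hsrc (\<Pi>\<^sub>2 X) a = Htgt (\<Pi>\<^sub>2 X) b" for a b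
  proof -
    obtain f g where f: "f \<in> square_maps X" "a = square_class X f"
      and g: "g \<in> square_maps X" "b = square_class X g"
      using ab(1,2) by (meson SqrE)
    then have fg: "hor_composable f g"
      using ab(3) by (simp add: composable_iff)
    show "Vsrc (\<Pi>\<^sub>2 X) (Hcomp (\<Pi>\<^sub>2 X) a b) = hcomp (\<Pi>\<^sub>2 X) (Vsrc (\<Pi>\<^sub>2 X) a) (Vsrc (\<Pi>\<^sub>2 X) b)"
      "Vtgt (\<Pi>\<^sub>2 X) (Hcomp (\<Pi>\<^sub>2 X) a b) = hcomp (\<Pi>\<^sub>2 X) (Vtgt (\<Pi>\<^sub>2 X) a) (Vtgt (\<Pi>\<^sub>2 X) b)"
      using f g fg
      by (simp_all add: Hcomp_square_class square_class_boundary hcomp_map_square_maps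
          edges_hcomp_map morphisms_simps)
  qed
  have Vcomp_boundary: "Hsrc (\<Pi>\<^sub>2 X) (Vcomp (\<Pi>\<^sub>2 X) a b) = vcomp (\<Pi>\<^sub>2 X) (Hsrc (\<Pi>\<^sub>2 X) a) (Hsrc (\<Pi>\<^sub>2 X) b)"
    "Htgt (\<Pi>\<^sub>2 X) (Vcomp (\<Pi>\<^sub>2 X) a b) = vcomp (\<Pi>\<^sub>2 X) (Htgt (\<Pi>\<^sub>2 X) a) (Htgt (\<Pi>\<^sub>2 X) b)"
    if ab: "a \<in> Sqr (\<Pi>\<^sub>2 X)" "b \<in> Sqr (\<Pi>\<^sub>2 X)" "Vsrc (\<Pi>\<^sub>2 X) a = Vtgt (\<Pi>\<^sub>2 X) b" for a b
  proof -
    obtain f g where f: "f \<in> square_maps X" "a = square_class X f"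
      and g: "g \<in> square_maps X" "b = square_class X g"
      using ab(1,2) by (meson SqrE)
    then have fg: "ver_composable f g"
      using ab(3) by (simp add: composable_iff)
    show "Hsrc (\<Pi>\<^sub>2 X) (Vcomp (\<Pi>\<^sub>2 X) a b) = vcomp (\<Pi>\<^sub>2 X) (Hsrc (\<Pi>\<^sub>2 X) a) (Hsrc (\<Pi>\<^sub>2 X) b)"
      "Htgt (\<Pi>\<^sub>2 X) (Vcomp (\<Pi>\<^sub>2 X) a b) = vcomp (\<Pi>\<^sub>2 X) (Htgt (\<Pi>\<^sub>2 X) a) (Htgt (\<Pi>\<^sub>2 X) b)"
      using f g fg
      by (simp_all add: Vcomp_square_class square_class_boundary vcomp_map_square_maps
          edges_vcomp_map morphisms_simps)
  qed
  have Vidt_hcomp: "Vidt (\<Pi>\<^sub>2 X) (hcomp (\<Pi>\<^sub>2 X) m n) = Hcomp (\<Pi>\<^sub>2 X) (Vidt (\<Pi>\<^sub>2 X) m) (Vidt (\<Pi>\<^sub>2 X) n)"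
    if mn: "m \<in> Hor (\<Pi>\<^sub>2 X)" "n \<in> Hor (\<Pi>\<^sub>2 X)" "hsrc (\<Pi>\<^sub>2 X) m = htgt (\<Pi>\<^sub>2 X) n" for m n
  proof -
    let ?m = "Vidt (\<Pi>\<^sub>2 X) m" and ?n = "Vidt (\<Pi>\<^sub>2 X) n"
    have sq: "?m \<in> Sqr (\<Pi>\<^sub>2 X)" "?n \<in> Sqr (\<Pi>\<^sub>2 X)" "Hsrc (\<Pi>\<^sub>2 X) ?m = Htgt (\<Pi>\<^sub>2 X) ?n"
      using mn by (simp_all add: Ver.idt_closed Vidt_boundary)
    have boundary: "Vsrc (\<Pi>\<^sub>2 X) ?m = m" "Vtgt (\<Pi>\<^sub>2 X) ?m = m" "Vsrc (\<Pi>\<^sub>2 X) ?n = n" "Vtgt (\<Pi>\<^sub>2 X) ?n = n"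
      using mn by (simp_all add: Ver.src_idt Ver.tgt_idt)
    have "Vcomp (\<Pi>\<^sub>2 X) ?m ?m = ?m" "Vcomp (\<Pi>\<^sub>2 X) ?n ?n = ?n"
      using Ver.comp_idt_left[OF sq(1)] Ver.comp_idt_left[OF sq(2)] by (simp_all add: boundary)
    then have "Vcomp (\<Pi>\<^sub>2 X) (Hcomp (\<Pi>\<^sub>2 X) ?m ?n) (Hcomp (\<Pi>\<^sub>2 X) ?m ?n) = Hcomp (\<Pi>\<^sub>2 X) ?m ?n"
      \<comment> \<open>Interchange for two equal rows; each column is an idempotent vertical
        identity.\<close>
      using interchange_classes[OF sq(1,2,1,2) sq(3) sq(3)] by (simp add: boundary)
    then show ?thesis
      using Ver.idempotent_eq_idt[OF Hor.comp_closed[OF sq]] by (simp add: Hcomp_boundary[OF sq] boundary)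
  qed
  have Hidt_vcomp: "Hidt (\<Pi>\<^sub>2 X) (vcomp (\<Pi>\<^sub>2 X) m n) = Vcomp (\<Pi>\<^sub>2 X) (Hidt (\<Pi>\<^sub>2 X) m) (Hidt (\<Pi>\<^sub>2 X) n)"
    if mn: "m \<in> Ver (\<Pi>\<^sub>2 X)" "n \<in> Ver (\<Pi>\<^sub>2 X)" "vsrc (\<Pi>\<^sub>2 X) m = vtgt (\<Pi>\<^sub>2 X) n" for m n
  proof -
    let ?m = "Hidt (\<Pi>\<^sub>2 X) m" and ?n = "Hidt (\<Pi>\<^sub>2 X) n"
    have sq: "?m \<in> Sqr (\<Pi>\<^sub>2 X)" "?n \<in> Sqr (\<Pi>\<^sub>2 X)" "Vsrc (\<Pi>\<^sub>2 X) ?m = Vtgt (\<Pi>\<^sub>2 X) ?n"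
      using mn by (simp_all add: Hor.idt_closed Hidt_boundary)
    have boundary: "Hsrc (\<Pi>\<^sub>2 X) ?m = m" "Htgt (\<Pi>\<^sub>2 X) ?m = m" "Hsrc (\<Pi>\<^sub>2 X) ?n = n" "Htgt (\<Pi>\<^sub>2 X) ?n = n"
      using mn by (simp_all add: Hor.src_idt Hor.tgt_idt)
    have "Hcomp (\<Pi>\<^sub>2 X) ?m ?m = ?m" "Hcomp (\<Pi>\<^sub>2 X) ?n ?n = ?n"
      using Hor.comp_idt_left[OF sq(1)] Hor.comp_idt_left[OF sq(2)] by (simp_all add: boundary)
    then have "Hcomp (\<Pi>\<^sub>2 X) (Vcomp (\<Pi>\<^sub>2 X) ?m ?n) (Vcomp (\<Pi>\<^sub>2 X) ?m ?n) = Vcomp (\<Pi>\<^sub>2 X) ?m ?n"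
      \<comment> \<open>Interchange for two equal columns, read from right to left.\<close>
      using interchange_classes[OF sq(1,1,2,2) _ _ sq(3) sq(3)] by (simp add: boundary)
    then show ?thesis
      using Hor.idempotent_eq_idt[OF Ver.comp_closed[OF sq]] by (simp add: Vcomp_boundary[OF sq] boundary)
  qed
  \<comment> \<open>Here idempotence comes from \<open>Vidt_hcomp\<close> applied to the composite
    of an identity with itself.\<close>
  have Hidt_vidt: "Hidt (\<Pi>\<^sub>2 X) (vidt (\<Pi>\<^sub>2 X) u) = Vidt (\<Pi>\<^sub>2 X) (hidt (\<Pi>\<^sub>2 X) u)" if u: "u \<in> Obj (\<Pi>\<^sub>2 X)" for u
  proof -
    let ?i = "hidt (\<Pi>\<^sub>2 X) u"
    have i: "?i \<in> Hor (\<Pi>\<^sub>2 X)" "hsrc (\<Pi>\<^sub>2 X) ?i = u" "htgt (\<Pi>\<^sub>2 X) ?i = u"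
      using u by (simp_all add: hor.idt_closed hor.src_idt hor.tgt_idt)
    have "Hcomp (\<Pi>\<^sub>2 X) (Vidt (\<Pi>\<^sub>2 X) ?i) (Vidt (\<Pi>\<^sub>2 X) ?i) = Vidt (\<Pi>\<^sub>2 X) ?i"
      using Vidt_hcomp[OF i(1) i(1)] hor.comp_idt_left[OF i(1)] i by simp
    then show ?thesis
      using Hor.idempotent_eq_idt[OF Ver.idt_closed[OF i(1)]] i by (simp add: Vidt_boundary)
  qed
  show ?thesis
  proof unfold_locales
    fix a assume "a \<in> Sqr (\<Pi>\<^sub>2 X)"
    then show "hsrc (\<Pi>\<^sub>2 X) (Vsrc (\<Pi>\<^sub>2 X) a) = vsrc (\<Pi>\<^sub>2 X) (Hsrc (\<Pi>\<^sub>2 X) a)"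
      "htgt (\<Pi>\<^sub>2 X) (Vtgt (\<Pi>\<^sub>2 X) a) = vtgt (\<Pi>\<^sub>2 X) (Htgt (\<Pi>\<^sub>2 X) a)"
      "hsrc (\<Pi>\<^sub>2 X) (Vtgt (\<Pi>\<^sub>2 X) a) = vtgt (\<Pi>\<^sub>2 X) (Hsrc (\<Pi>\<^sub>2 X) a)"
      "vsrc (\<Pi>\<^sub>2 X) (Htgt (\<Pi>\<^sub>2 X) a) = htgt (\<Pi>\<^sub>2 X) (Vsrc (\<Pi>\<^sub>2 X) a)"
      by (auto elim!: SqrE simp: square_class_boundary morphisms_simps)
  qed (fact Hidt_boundary Vidt_boundary Hcomp_boundary Vcomp_boundary Vidt_hcomp Hidt_vcomp Hidt_vidt
      interchange_classes)+
qed

text \<open>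
  A filler is obtained by projecting the square onto its bottom, left and top edges along
  \<open>(x, y) \<mapsto> y + x * (2 * y - 1)\<close>, where these three edges are parametrised by
  \<open>[-1, 0]\<close>, \<open>[0, 1]\<close> and \<open>[1, 2]\<close>.
\<close>

lemma filling_condition_homotopy_classes: "filling_condition (\<Pi>\<^sub>2 X)"
  unfolding filling_condition_def
proof (intro ballI impI)
  fix g m assume "g \<in> Hor (\<Pi>\<^sub>2 X)" "m \<in> Ver (\<Pi>\<^sub>2 X)" "hsrc (\<Pi>\<^sub>2 X) g = vtgt (\<Pi>\<^sub>2 X) m"
  then obtain u v v' where m: "m = (u, v)" and g: "g = (v, v')"
    and paths: "u \<in> paths X" "v \<in> paths X" "v' \<in> paths X" and ends: "u 0 = v 0" "v 1 = v' 1"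
    by (auto simp: morphisms_simps)
  have cont: "continuous_map (top_of_set {0..1}) X u" "continuous_map (top_of_set {0..1}) X v"
    "continuous_map (top_of_set {0..1}) X v'" 
    using paths by (auto simp: paths_def pathin_def)
  \<comment> \<open>The path runs backwards along \<open>u\<close>, then along \<open>v\<close>,
    then backwards along \<open>v'\<close>; the common end points in \<open>ends\<close> make it
    continuous. The projection takes the right edge \<open>x = 1\<close> to
    \<open>3 * y - 1\<close>, so the fourth side of the filler is the entire path.\<close>
  let ?c = "\<lambda>t::real. if t \<le> 0 then u (- t) else if t \<le> 1 then v t else v' (2 - t)"
  let ?f = "\<lambda>(x, y)\<in>unit_square. ?c (y + x * (2 * y - 1))"
  have c: "continuous_map (top_of_set {-1..2}) X ?c"
  proof (rule continuous_map_paste_le)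
    show "continuous_map (top_of_set {t \<in> {-1..2}. t \<le> 0}) X (\<lambda>t. u (- t))"
      by (rule continuous_map_reparam[OF cont(1), where r = "\<lambda>t. - t"]) (auto intro!: continuous_intros)
    show "continuous_map (top_of_set {t \<in> {-1..2}. 0 \<le> t}) X (\<lambda>t. if t \<le> 1 then v t else v' (2 - t))"
    proof (rule continuous_map_paste_le)
      show "continuous_map (top_of_set {t \<in> {t \<in> {-1..2}. 0 \<le> t}. t \<le> 1}) X v"
        by (rule continuous_map_reparam[OF cont(2), where r = "\<lambda>t. t"]) auto
      show "continuous_map (top_of_set {t \<in> {t \<in> {-1..2}. 0 \<le> t}. 1 \<le> t}) X (\<lambda>t. v' (2 - t))"
        by (rule continuous_map_reparam[OF cont(3), where r = "\<lambda>t. 2 - t"]) (auto intro!: continuous_intros)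
    qed (use ends in \<open>auto intro!: continuous_intros\<close>)
  qed (use ends in \<open>auto intro!: continuous_intros\<close>)
  have range: "y + x * (2 * y - 1) \<in> {-1..2}" if "(x, y) \<in> unit_square" for x y :: real
  proof -
    have "\<bar>x * (2 * y - 1)\<bar> \<le> 1 * 1"
      unfolding abs_mult using that by (intro mult_mono) auto
    then show ?thesis
      using that by auto
  qed
  have "continuous_map (top_of_set unit_square) X (\<lambda>z. ?c (snd z + fst z * (2 * snd z - 1)))"
    by (rule continuous_map_reparam[OF c, where r = "\<lambda>z. snd z + fst z * (2 * snd z - 1)"])
      (use range in \<open>auto intro!: continuous_intros\<close>)
  from continuous_map_restrict[OF this] have f: "?f \<in> square_maps X"
    by (simp add: square_maps_def case_prod_unfold)
  have "edge_u ?f = u" "edge_v ?f = v" "edge_v' ?f = v'"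
    using paths ends
    by (auto simp: edge_u_def edge_v_def edge_v'_def paths_def extensional_def fun_eq_iff intro: antisym)
  then have "Hsrc (\<Pi>\<^sub>2 X) (square_class X ?f) = m \<and> Vtgt (\<Pi>\<^sub>2 X) (square_class X ?f) = g"
    by (simp add: square_class_boundary[OF f] m g)
  then show "\<exists>a\<in>Sqr (\<Pi>\<^sub>2 X). Hsrc (\<Pi>\<^sub>2 X) a = m \<and> Vtgt (\<Pi>\<^sub>2 X) a = g"
    using square_class_in_Sqr[OF f] by blast
qed

theorem theorem4p1:
  fixes X :: "'a topology"
  shows "double_groupoid (homotopy_double_groupoid X) \<and>
         filling_condition (homotopy_double_groupoid X)"
  by (simp add: double_groupoid_homotopy_classes filling_condition_homotopy_classes)

end
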